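(* Let $\nu\in\mathbb{R}$, let $r\ge0$ be an integer, and suppose that $Z\subset[0,1)\times\mathbb{R}$ is a separated sequence. If $D^+(Z)<\frac{1}{r+1}$, then $Z$ is interpolating for $\mathcal{F}_\nu^{(r)}(\mathbb{C}/\mathbb{Z})$.
   Context: Identify $z=x+i\xi\in\mathbb{C}$ with $(x,\xi)\in\mathbb{R}^2$. $\mathcal{F}_{2,\nu}(\mathbb{C}/\mathbb{Z})$ is the space of entire functions $F_0$ with $F_0(z+k)=e^{2\pi i k\nu}e^{\frac{\pi}{2}k^2+\pi zk}F_0(z)$ for all $z\in\mathbb{C}$, $k\in\mathbb{Z}$, and $\int_{[0,1)\times\mathbb{R}}|F_0(z)|^2e^{-\pi|z|^2}dz<\infty$ ($dz$ is Lebesgue measure). The true polyanalytic Fock space $\mathcal{F}_\nu^{(r)}(\mathbb{C}/\mathbb{Z})$ is the space of all functions $F(z)=\left(\frac{\pi^r}{r!}\right)^{1/2}e^{\pi|z|^2}\partial_z^r\left[e^{-\pi|z|^2}F_0(z)\right]$ with $F_0\in\mathcal{F}_{2,\nu}(\mathbb{C}/\mathbb{Z})$, with norm $\|F\|^2=\int_{[0,1)\times\mathbb{R}}|F(z)|^2e^{-\pi|z|^2}dz$; such $F$ satisfy the same functional equation. A sequence $Z=\{z_k\}\subset[0,1)\times\mathbb{R}$ of distinct points is separated if $\inf_{j\ne k}|z_j-z_k|>0$. For $w\in\mathbb{C}$ and $\rho>0$ let $I_{w,\rho}=[0,1]\times[\Im w-\frac{\rho}{2},\Im w+\frac{\rho}{2}]$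 and let $n(Z,I_{w,\rho})$ be the number of points of $Z\cap I_{w,\rho}$; the upper Beurling density is $D^+(Z)=\limsup_{\rho\to\infty}\sup_{w\in\mathbb{C}/\mathbb{Z}}\frac{n(Z,I_{w,\rho})}{\rho}$. $Z=\{z_k\}$ is interpolating for $\mathcal{F}_\nu^{(r)}(\mathbb{C}/\mathbb{Z})$ if there is a constant $C$ such that for every sequence $(a_k)$ with $\sum_k|a_k|^2e^{-\pi|z_k|^2}<\infty$ there is $F\in\mathcal{F}_\nu^{(r)}(\mathbb{C}/\mathbb{Z})$ with $F(z_k)=a_k$ for all $k$ and $\|F\|\le C\left(\sum_k|a_k|^2e^{-\pi|z_k|^2}\right)^{1/2}$.
   Formalization: Separation is required in the distance of ℂ/ℤ (inf over integers m of |z_j−z_k+m|) instead of the planar |z_j−z_k|; with planar distance the claim fails, e.g. for Z={inL}∪{1−1/n+inL : n≥2} with L>2(r+1). *)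

theory Defs
  imports "HOL-Analysis.Analysis"
begin

text \<open>A complex number \<open>z\<close> stands for the point \<open>(Re z, Im z)\<close> of the plane, and the half-open
  strip below is the fundamental domain of \<open>\<complex>/\<int>\<close>.\<close>

definition strip :: "complex set" where
  "strip = {z. 0 \<le> Re z \<and> Re z < 1}"

definition quasi_periodic :: "real \<Rightarrow> (complex \<Rightarrow> complex) \<Rightarrow> bool" where
  "quasi_periodic \<nu> F \<longleftrightarrow>
     (\<forall>z. \<forall>k::int. F (z + of_int k) =
        exp (2 * of_real pi * \<i> * of_int k * of_real \<nu>) *
        exp (of_real pi / 2 * (of_int k)\<^sup>2 + of_real pi * z * of_int k) * F z)"

definition fock_square_integrable :: "(complex \<Rightarrow> complex) \<Rightarrow> bool" where
  "fock_square_integrable F \<longleftrightarrow>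
     set_integrable lborel strip (\<lambda>z. (cmod (F z))\<^sup>2 * exp (- pi * (cmod z)\<^sup>2))"

text \<open>Meaningful only under \<^const>\<open>fock_square_integrable\<close>: the Bochner integral of a
  non-integrable function is 0.\<close>

definition fock_norm :: "(complex \<Rightarrow> complex) \<Rightarrow> real" where
  "fock_norm F = sqrt (LINT z:strip|lborel. (cmod (F z))\<^sup>2 * exp (- pi * (cmod z)\<^sup>2))"

definition fock_space :: "real \<Rightarrow> (complex \<Rightarrow> complex) set" where
  "fock_space \<nu> = {F. F holomorphic_on UNIV \<and> quasi_periodic \<nu> F \<and> fock_square_integrable F}"

text \<open>The Wirtinger derivative \<open>\<partial>\<^sub>z = (\<partial>\<^sub>x - \<i> \<partial>\<^sub>\<xi>) / 2\<close>. The functions it is applied to are smooth but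
  not holomorphic, so the complex derivative is of no use here.\<close>

definition wirtinger :: "(complex \<Rightarrow> complex) \<Rightarrow> complex \<Rightarrow> complex" where
  "wirtinger f z =
     (vector_derivative (\<lambda>t::real. f (z + of_real t)) (at 0)
      - \<i> * vector_derivative (\<lambda>t::real. f (z + \<i> * of_real t)) (at 0)) / 2"

definition true_poly :: "nat \<Rightarrow> (complex \<Rightarrow> complex) \<Rightarrow> complex \<Rightarrow> complex" where
  "true_poly r F\<^sub>0 z =
     of_real (sqrt (pi ^ r / fact r)) * of_real (exp (pi * (cmod z)\<^sup>2)) *
     (wirtinger ^^ r) (\<lambda>w. of_real (exp (- pi * (cmod w)\<^sup>2)) * F\<^sub>0 w) z"

definition true_poly_fock_space :: "real \<Rightarrow> nat \<Rightarrow> (complex \<Rightarrow> complex) set" where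
  "true_poly_fock_space \<nu> r = true_poly r ` fock_space \<nu>"

text \<open>A sequence of distinct points is represented by the set of its terms, which may be finite.
  Distances are those of \<open>\<complex>/\<int>\<close>, the distance between the classes of \<open>z\<close> and \<open>w\<close> being
  the infimum over \<open>m \<in> \<int>\<close> of \<open>cmod (z - w + m)\<close>. The planar distance between representatives in
  the strip would not do: points close to the two opposite edges can be arbitrarily close in
  \<open>\<complex>/\<int>\<close>, and then the weighted modulus of a quasi-periodic function takes nearly equal values there.\<close>

definition separated :: "complex set \<Rightarrow> bool" where
  "separated Z \<longleftrightarrow>
     (\<exists>\<delta>>0. \<forall>z\<in>Z. \<forall>w\<in>Z. z \<noteq> w \<longrightarrow> (\<forall>m::int. \<delta> \<le> cmod (z - w + of_int m)))"

definition box_at :: "complex \<Rightarrow> real \<Rightarrow> complex set" where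
  "box_at w \<rho> = {z. 0 \<le> Re z \<and> Re z \<le> 1 \<and> Im w - \<rho> / 2 \<le> Im z \<and> Im z \<le> Im w + \<rho> / 2}"

text \<open>Points are counted with the counting measure, so that an infinite set has infinitely many.
  The supremum may run over all of \<open>\<complex>\<close>, since \<^const>\<open>box_at\<close> depends on \<open>Im w\<close> only.\<close>

definition upper_beurling_density :: "complex set \<Rightarrow> ennreal" where
  "upper_beurling_density Z =
     Limsup at_top (\<lambda>\<rho>::real. SUP w. emeasure (count_space UNIV) (Z \<inter> box_at w \<rho>) / ennreal \<rho>)"

definition interpolating :: "real \<Rightarrow> nat \<Rightarrow> complex set \<Rightarrow> bool" where
  "interpolating \<nu> r Z \<longleftrightarrow>
     (\<exists>C::real. \<forall>a::complex \<Rightarrow> complex.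
        (\<lambda>z. (cmod (a z))\<^sup>2 * exp (- pi * (cmod z)\<^sup>2)) summable_on Z \<longrightarrow>
        (\<exists>F \<in> true_poly_fock_space \<nu> r.
           (\<forall>z\<in>Z. F z = a z) \<and> fock_square_integrable F \<and>
           fock_norm F \<le> C * sqrt (\<Sum>\<^sub>\<infinity>z\<in>Z. (cmod (a z))\<^sup>2 * exp (- pi * (cmod z)\<^sup>2))))"

end

theory Submission
  imports Defs "HOL-Complex_Analysis.Complex_Analysis"
begin

text \<open>
  Fix \<open>z\<^sub>k \<in> Z\<close> and write \<open>z\<^sub>k = x\<^sub>k + \<i> \<xi>\<^sub>k\<close>. It suffices to find a fundamental function for \<open>z\<^sub>k\<close>, that is
  some \<open>B\<^sub>k\<close> in the analytic Fock space whose image under \<^const>\<open>true_poly\<close> is 1 at \<open>z\<^sub>k\<close> and 0 at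
  the other points of \<open>Z\<close>, with a bound
  \<open>|B\<^sub>k z| exp (- \<pi> |z|\<^sup>2 / 2) \<le> C exp (- \<pi> |z\<^sub>k|\<^sup>2 / 2) exp (- |Im z - \<xi>\<^sub>k|)\<close>
  uniform in \<open>k\<close>. Then \<open>F\<^sub>0 = \<Sum>k. a\<^sub>k B\<^sub>k\<close> solves the interpolation problem: exponential decay and the
  bounded density of \<open>Z\<close> turn \<open>\<ell>\<^sup>2\<close> data into square integrable functions by the Cauchy-Schwarz
  inequality (\<open>fock_norm_le_of_envelope\<close>), and Cauchy's estimate on unit circles carries pointwise
  bounds from \<open>F\<^sub>0\<close> to \<open>true_poly r F\<^sub>0\<close> (\<open>true_poly_bound\<close>).

  The vanishing conditions become conditions on zeros because, up to a constant,
  \<open>true_poly r F\<^sub>0\<close> at \<open>w\<close> is \<open>exp (\<pi> |w|\<^sup>2)\<close> times the \<open>r\<close>-th complex derivative at \<open>u = w\<close> of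
  \<open>exp (- \<pi> u (cnj w)) F\<^sub>0 u\<close>: it vanishes at a zero of order \<open>r + 1\<close>, and at a zero of order
  \<open>r\<close> it only sees the leading coefficient.

  Quasi-periodicity says that \<open>exp (- \<pi> z\<^sup>2 / 2) F\<^sub>0 z\<close> is \<open>exp (2 \<pi> \<i> \<nu> z)\<close> times a function of
  \<open>exp (2 \<pi> \<i> z)\<close>. The cylinder has two ends, and a zero at \<open>z\<^sub>j\<close> can be produced by
  \<open>1 - exp (\<plusminus> 2 \<pi> \<i> (z - z\<^sub>j))\<close>, which tends to 1 at the end chosen by the sign. Taking the end opposite to the
  points \<open>z\<^sub>j\<close>, as seen from \<open>z\<^sub>k\<close>, gives a convergent product \<open>P\<close> over \<open>j \<noteq> k\<close>
  (\<open>ex_punctured_product\<close>). At height \<open>t\<close> from \<open>z\<^sub>k\<close> the factors that are large are those of the points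
  between the two heights, so that for density \<open>d\<close> the function \<open>ln |P|\<close> is at most
  \<open>\<integral> 2 \<pi> d (|t| - s) ds = \<pi> d t\<^sup>2\<close> (\<open>0 \<le> s \<le> |t|\<close>) up to a linear term, while separation keeps \<open>|P z\<^sub>k|\<close> away from 0. The function
  \<open>exp (\<pi> z\<^sup>2 / 2) exp (2 \<pi> \<i> (n + \<nu>) (z - z\<^sub>k)) (1 - exp (2 \<pi> \<i> (z - z\<^sub>k)))\<^sup>r (P z)\<^sup>r\<^sup>+\<^sup>1\<close>,
  with \<open>n\<close> the integer part of \<open>- \<xi>\<^sub>k - \<nu>\<close>, has the zeros that are needed; in the Fock weight its
  first two factors decay like \<open>exp (- \<pi> t\<^sup>2)\<close> up to a factor exponential in \<open>|t|\<close>, and the rest grows at most like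
  \<open>exp (\<pi> (r + 1) d t\<^sup>2)\<close>. This is where \<open>d < 1 / (r + 1)\<close> enters
  (\<open>ex_fundamental_function\<close>).
\<close>

section \<open>True polyanalytic functions through complex derivatives\<close>

text \<open>A real-linear map of the plane is \<open>h \<mapsto> a h + b (cnj h)\<close>; the operator picks the complex-linear part.\<close>

lemma wirtinger_eq:
  assumes "(f has_derivative (\<lambda>h. a * h + b * cnj h)) (at z)"
  shows "wirtinger f z = a"
proof -
  have 1: "((\<lambda>t::real. f (z + of_real t)) has_vector_derivative (a + b)) (at 0)"
  proof -
    have "((\<lambda>t::real. z + of_real t) has_vector_derivative 1) (at 0)"
      by (auto intro!: derivative_eq_intros)
    moreover have "(f has_derivative (\<lambda>h. a * h + b * cnj h)) (at (z + of_real 0))"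
      using assms by simp
    ultimately show ?thesis
      unfolding has_vector_derivative_def
      by (auto dest!: has_derivative_compose elim!: has_derivative_eq_rhs simp: fun_eq_iff algebra_simps scaleR_conv_of_real)
  qed
  have 2: "((\<lambda>t::real. f (z + \<i> * of_real t)) has_vector_derivative (a * \<i> - b * \<i>)) (at 0)"
  proof -
    have "((\<lambda>t::real. z + \<i> * of_real t) has_vector_derivative \<i>) (at 0)"
      by (auto intro!: derivative_eq_intros)
    moreover have "(f has_derivative (\<lambda>h. a * h + b * cnj h)) (at (z + \<i> * of_real 0))"
      using assms by simp
    ultimately show ?thesis
      unfolding has_vector_derivative_def
      by (auto dest!: has_derivative_compose elim!: has_derivative_eq_rhs simp: fun_eq_iff algebra_simps scaleR_conv_of_real)
  qed
  have "\<i> * (a * \<i> - b * \<i>) = b - a" by (simp add: algebra_simps)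
  thus ?thesis
    unfolding wirtinger_def vector_derivative_at[OF 1] vector_derivative_at[OF 2]
    by simp
qed

text \<open>The operator treats \<open>cnj w\<close> as a constant. For the functions met below this means: freeze
  \<open>cnj w\<close>, and take the complex derivative in the remaining variable.\<close>

lemma wirtinger_sesqui_sum:
  fixes g :: "nat \<Rightarrow> complex \<Rightarrow> complex"
  assumes "finite I" "\<And>i. i \<in> I \<Longrightarrow> g i holomorphic_on UNIV"
  shows "wirtinger (\<lambda>w. \<Sum>i\<in>I. c i * cnj w ^ m i * exp (- of_real pi * w * cnj w) * g i w) w =
    deriv (\<lambda>z. \<Sum>i\<in>I. c i * cnj w ^ m i * exp (- of_real pi * z * cnj w) * g i z) w"
proof -
  have g': "(g i has_field_derivative deriv (g i) x) (at x)" if "i \<in> I" for i x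
    using assms(2)[OF that] holomorphic_derivI[of "g i" UNIV x] by simp
  define A where "A = (\<Sum>i\<in>I. c i * cnj w ^ m i * (exp (- of_real pi * w * cnj w) * deriv (g i) w
      - of_real pi * cnj w * exp (- of_real pi * w * cnj w) * g i w))"
  define B where "B = (\<Sum>i\<in>I. c i * exp (- of_real pi * w * cnj w) * g i w *
      (of_nat (m i) * cnj w ^ (m i - 1) - cnj w ^ m i * of_real pi * w))"
  have "((\<lambda>w. c i * cnj w ^ m i * exp (- of_real pi * w * cnj w) * g i w) has_derivative
      (\<lambda>h. (c i * cnj w ^ m i * (exp (- of_real pi * w * cnj w) * deriv (g i) w
      - of_real pi * cnj w * exp (- of_real pi * w * cnj w) * g i w)) * h +
      (c i * exp (- of_real pi * w * cnj w) * g i w *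
      (of_nat (m i) * cnj w ^ (m i - 1) - cnj w ^ m i * of_real pi * w)) * cnj h)) (at w)" if "i \<in> I" for i
  proof -
    have g: "(g i has_derivative (\<lambda>h. deriv (g i) w * h)) (at w)"
      using g'[OF that] by (simp add: has_field_derivative_def)
    have e: "((\<lambda>w. exp (- of_real pi * w * cnj w)) has_derivative
       (\<lambda>h. exp (- of_real pi * w * cnj w) * (- of_real pi * (h * cnj w + w * cnj h)))) (at w)"
    proof -
      have "((\<lambda>w. - of_real pi * w * cnj w) has_derivative (\<lambda>h. - of_real pi * (h * cnj w + w * cnj h))) (at w)"
        by (auto intro!: derivative_eq_intros simp: algebra_simps)
      from has_derivative_compose[OF this, of exp "\<lambda>h. exp (- of_real pi * w * cnj w) * h"]
      show ?thesis using DERIV_exp[of "- of_real pi * w * cnj w"]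
        by (simp add: has_field_derivative_def)
    qed
    have "((\<lambda>w. c i * cnj w ^ m i * exp (- of_real pi * w * cnj w) * g i w) has_derivative
       (\<lambda>h. c i * cnj w ^ m i * exp (- of_real pi * w * cnj w) * (deriv (g i) w * h) +
          (c i * cnj w ^ m i * (exp (- of_real pi * w * cnj w) * (- of_real pi * (h * cnj w + w * cnj h))) +
           (c i * (of_nat (m i) * cnj h * cnj w ^ (m i - 1))) * exp (- of_real pi * w * cnj w)) * g i w)) (at w)"
      by (rule has_derivative_mult has_derivative_mult_right has_derivative_power has_derivative_cnj
          has_derivative_ident g e)+
    thus ?thesis by (rule has_derivative_eq_rhs) (auto simp: algebra_simps fun_eq_iff)
  qed
  hence "((\<lambda>w. \<Sum>i\<in>I. c i * cnj w ^ m i * exp (- of_real pi * w * cnj w) * g i w) has_derivative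
     (\<lambda>h. A * h + B * cnj h)) (at w)"
    unfolding A_def B_def sum_distrib_right sum.distrib[symmetric]
    by (rule has_derivative_sum)
  hence 1: "wirtinger (\<lambda>w. \<Sum>i\<in>I. c i * cnj w ^ m i * exp (- of_real pi * w * cnj w) * g i w) w = A"
    by (rule wirtinger_eq)
  have "((\<lambda>z. \<Sum>i\<in>I. c i * cnj w ^ m i * exp (- of_real pi * z * cnj w) * g i z) has_field_derivative A) (at w)"
    unfolding A_def
    by (rule DERIV_sum) (auto intro!: derivative_eq_intros g' simp: algebra_simps)
  hence 2: "deriv (\<lambda>z. \<Sum>i\<in>I. c i * cnj w ^ m i * exp (- of_real pi * z * cnj w) * g i z) w = A"
    by (rule DERIV_imp_deriv)
  show ?thesis using 1 2 by simp
qed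

lemma higher_deriv_exp_mult:
  assumes "F holomorphic_on UNIV"
  shows "(deriv ^^ n) (\<lambda>u. exp (- of_real pi * u * s) * F u) z =
    (\<Sum>i\<le>n. (of_nat (n choose i) * (- of_real pi) ^ i) * s ^ i * exp (- of_real pi * z * s) * (deriv ^^ (n - i)) F z)"
proof -
  have e: "(deriv ^^ i) (\<lambda>u. exp (- of_real pi * u * s)) z = (- of_real pi) ^ i * s ^ i * exp (- of_real pi * z * s)" for i z
  proof (induction i arbitrary: z)
    case (Suc i)
    have "(deriv ^^ Suc i) (\<lambda>u. exp (- of_real pi * u * s)) z
       = deriv (\<lambda>z. (- of_real pi) ^ i * s ^ i * exp (- of_real pi * z * s)) z"
      by (simp only: funpow.simps(2) o_apply ext[of "(deriv ^^ i) (\<lambda>u. exp (- of_real pi * u * s))", OF Suc.IH])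
    also have "\<dots> = (- of_real pi) ^ Suc i * s ^ Suc i * exp (- of_real pi * z * s)"
      by (rule DERIV_imp_deriv) (auto intro!: derivative_eq_intros)
    finally show ?case .
  qed auto
  have "(\<lambda>u. exp (- of_real pi * u * s)) holomorphic_on UNIV" by (intro holomorphic_intros)
  from higher_deriv_mult[OF this assms open_UNIV UNIV_I, of n z] show ?thesis
    unfolding e by (simp only: atMost_atLeast0 mult_ac)
qed

text \<open>Since \<open>|w|\<^sup>2 = w (cnj w)\<close>, freezing \<open>cnj w\<close> once is enough for all \<open>n\<close> derivatives. This replaces the
  iterated operator on smooth functions by derivatives of an entire function.\<close>

lemma wirtinger_power_eq_higher_deriv:
  assumes "F holomorphic_on UNIV"
  shows "(wirtinger ^^ n) (\<lambda>w. of_real (exp (- pi * (cmod w)\<^sup>2)) * F w) w =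
         (deriv ^^ n) (\<lambda>u. exp (- of_real pi * u * cnj w) * F u) w"
proof (induction n arbitrary: w)
  case 0
  have "- complex_of_real pi * w * cnj w = of_real (- pi * (cmod w)\<^sup>2)"
    by (simp only: of_real_mult of_real_minus complex_norm_square mult.assoc)
  then show ?case by (simp only: exp_of_real funpow_0)
next
  case (Suc n)
  let ?G = "\<lambda>s z. \<Sum>i\<le>n. (of_nat (n choose i) * (- of_real pi) ^ i) * s ^ i * exp (- of_real pi * z * s) * (deriv ^^ (n - i)) F z"
  have "(wirtinger ^^ Suc n) (\<lambda>w. of_real (exp (- pi * (cmod w)\<^sup>2)) * F w) w =
      wirtinger (\<lambda>w. (deriv ^^ n) (\<lambda>u. exp (- of_real pi * u * cnj w) * F u) w) w"
    using Suc.IH by (metis (no_types, lifting) ext funpow.simps(2) o_apply)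
  also have "(\<lambda>w. (deriv ^^ n) (\<lambda>u. exp (- of_real pi * u * cnj w) * F u) w) = (\<lambda>w. ?G (cnj w) w)"
    by (rule ext) (rule higher_deriv_exp_mult[OF assms])
  also have "wirtinger \<dots> w = deriv (\<lambda>z. ?G (cnj w) z) w"
    by (rule wirtinger_sesqui_sum) (use assms in \<open>auto intro!: holomorphic_higher_deriv\<close>)
  also have "(\<lambda>z. ?G (cnj w) z) = (deriv ^^ n) (\<lambda>u. exp (- of_real pi * u * cnj w) * F u)"
    by (rule ext) (rule higher_deriv_exp_mult[OF assms, symmetric])
  finally show ?case by simp
qed

lemma true_poly_eq:
  assumes "F holomorphic_on UNIV"
  shows "true_poly r F w = of_real (sqrt (pi ^ r / fact r)) * of_real (exp (pi * (cmod w)\<^sup>2)) *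
         (deriv ^^ r) (\<lambda>u. exp (- of_real pi * u * cnj w) * F u) w"
  unfolding true_poly_def wirtinger_power_eq_higher_deriv[OF assms] ..

lemma continuous_true_poly:
  assumes "F holomorphic_on UNIV"
  shows "continuous_on UNIV (true_poly r F)"
proof -
  have "continuous_on UNIV ((deriv ^^ i) F)" for i
    using holomorphic_higher_deriv[OF assms open_UNIV] holomorphic_on_imp_continuous_on by blast
  moreover have "true_poly r F = (\<lambda>w. of_real (sqrt (pi ^ r / fact r)) * of_real (exp (pi * (cmod w)\<^sup>2)) *
     (\<Sum>i\<le>r. (of_nat (r choose i) * (- of_real pi) ^ i) * cnj w ^ i * exp (- of_real pi * w * cnj w) * (deriv ^^ (r - i)) F w))"
    using true_poly_eq[OF assms] higher_deriv_exp_mult[OF assms] by (auto simp: fun_eq_iff)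
  ultimately show ?thesis by (auto intro!: continuous_intros)
qed

text \<open>Expanding \<open>|z - w|\<^sup>2\<close>: the factor that freezing produces shifts the Gaussian weight from \<open>w\<close> to \<open>z\<close> at
  a cost depending on \<open>|z - w|\<close> alone.\<close>

lemma norm_exp_gaussian:
  "cmod (exp (- of_real pi * z * cnj w)) * exp (pi * (cmod w)\<^sup>2) =
   exp (pi / 2 * (cmod (z - w))\<^sup>2) * exp (- pi / 2 * (cmod z)\<^sup>2) * exp (pi / 2 * (cmod w)\<^sup>2)"
proof -
  have "- pi * Re (z * cnj w) + pi * (cmod w)\<^sup>2 = pi / 2 * (cmod (z - w))\<^sup>2 + - pi / 2 * (cmod z)\<^sup>2 + pi / 2 * (cmod w)\<^sup>2"
    unfolding cmod_power2 by (simp add: power2_eq_square field_simps)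
  moreover have "cmod (exp (- of_real pi * z * cnj w)) = exp (- pi * Re (z * cnj w))"
    by (simp add: norm_exp_eq_Re algebra_simps)
  ultimately show ?thesis by (metis exp_add)
qed

text \<open>Cauchy's estimate on the unit circle about \<open>w\<close>, in the Gaussian weight.\<close>

lemma true_poly_bound:
  assumes "F holomorphic_on UNIV"
    and "\<And>z. cmod (z - w) = 1 \<Longrightarrow> cmod (F z) * exp (- pi / 2 * (cmod z)\<^sup>2) \<le> B"
  shows "cmod (true_poly r F w) * exp (- pi / 2 * (cmod w)\<^sup>2)
     \<le> sqrt (pi ^ r / fact r) * fact r * exp (pi / 2) * B"
proof -
  let ?f = "\<lambda>u. exp (- of_real pi * u * cnj w) * F u"
  have hol: "?f holomorphic_on UNIV" using assms(1) by (intro holomorphic_intros)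
  have bd: "cmod (?f z) \<le> exp (- pi / 2 * (cmod w)\<^sup>2) * exp (pi / 2) * B" if "cmod (w - z) = 1" for z
  proof -
    have z: "cmod (z - w) = 1" using that by (simp add: norm_minus_commute)
    have "cmod (?f z) * exp (pi * (cmod w)\<^sup>2) = exp (pi/2) * exp (pi / 2 * (cmod w)\<^sup>2) * (cmod (F z) * exp (- pi / 2 * (cmod z)\<^sup>2))"
      using norm_exp_gaussian[of z w] z by (simp add: norm_mult algebra_simps)
    also have "\<dots> \<le> exp (pi/2) * exp (pi / 2 * (cmod w)\<^sup>2) * B"
      using assms(2)[OF z] by (intro mult_left_mono) auto
    also have "exp (pi / 2 * (cmod w)\<^sup>2) = exp (pi * (cmod w)\<^sup>2) * exp (- pi / 2 * (cmod w)\<^sup>2)"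
      by (simp flip: exp_add)
    finally show ?thesis by (simp add: algebra_simps)
  qed
  have H: "cmod ((deriv ^^ r) ?f w) \<le> fact r * (exp (- pi / 2 * (cmod w)\<^sup>2) * exp (pi / 2) * B) / 1 ^ r"
    using hol by (intro Cauchy_inequality bd) (auto intro: holomorphic_on_subset holomorphic_on_imp_continuous_on)
  have "cmod (true_poly r F w) = sqrt (pi ^ r / fact r) * exp (pi * (cmod w)\<^sup>2) * cmod ((deriv ^^ r) ?f w)"
    unfolding true_poly_eq[OF assms(1)] by (simp add: norm_mult)
  hence "cmod (true_poly r F w) * exp (- pi / 2 * (cmod w)\<^sup>2)
     \<le> sqrt (pi ^ r / fact r) * exp (pi * (cmod w)\<^sup>2) * (fact r * (exp (- pi / 2 * (cmod w)\<^sup>2) * exp (pi / 2) * B)) * exp (- pi / 2 * (cmod w)\<^sup>2)"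
    using H by (simp only: power_one div_by_1) (intro mult_right_mono mult_left_mono, auto)
  also have "\<dots> = sqrt (pi ^ r / fact r) * fact r * exp (pi / 2) * B"
  proof -
    have "exp (pi * (cmod w)\<^sup>2) * exp (- pi / 2 * (cmod w)\<^sup>2) * exp (- pi / 2 * (cmod w)\<^sup>2) = 1"
      by (simp flip: exp_add)
    hence "c * exp (pi * (cmod w)\<^sup>2) * (d * (exp (- pi / 2 * (cmod w)\<^sup>2) * e * B)) * exp (- pi / 2 * (cmod w)\<^sup>2) = c * d * e * B" for c d e
      by (simp only: mult_ac)
    thus ?thesis .
  qed
  finally show ?thesis .
qed

text \<open>Every derivative consumes one factor \<open>\<phi>\<close>; one that does not hit a factor \<open>\<phi>\<close> leaves too many of them
  to survive at the zero \<open>a\<close>.\<close>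

lemma higher_deriv_power_mult_at_zero:
  fixes \<phi> h :: "complex \<Rightarrow> complex"
  assumes "\<phi> holomorphic_on UNIV" "h holomorphic_on UNIV" "\<phi> a = 0"
  shows "(deriv ^^ r) (\<lambda>z. \<phi> z ^ r * h z) a = fact r * deriv \<phi> a ^ r * h a"
  using assms(2)
proof (induction r arbitrary: h)
  case (Suc r)
  let ?k = "\<lambda>z. of_nat (Suc r) * deriv \<phi> z * h z + \<phi> z * deriv h z"
  have d: "(\<phi> has_field_derivative deriv \<phi> z) (at z)" "(h has_field_derivative deriv h z) (at z)" for z
    using assms(1) Suc.prems holomorphic_derivI by blast+
  have "deriv (\<lambda>z. \<phi> z ^ Suc r * h z) = (\<lambda>z. \<phi> z ^ r * ?k z)"
    by (rule ext, rule DERIV_imp_deriv, rule DERIV_cong[OF DERIV_mult[OF DERIV_power[OF d(1)] d(2)]])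
      (simp add: algebra_simps)
  hence "(deriv ^^ Suc r) (\<lambda>z. \<phi> z ^ Suc r * h z) a = (deriv ^^ r) (\<lambda>z. \<phi> z ^ r * ?k z) a"
    by (simp only: funpow_Suc_right o_apply)
  also have "\<dots> = fact r * deriv \<phi> a ^ r * ?k a"
    by (rule Suc.IH) (use assms(1) Suc.prems in \<open>auto intro!: holomorphic_intros\<close>)
  finally show ?case using assms(3) by (simp add: algebra_simps)
qed auto

text \<open>Both cases of interpolation are instances: at its own point a fundamental function has a zero of
  order exactly \<open>r\<close>, at the others \<open>h\<close> vanishes as well.\<close>

lemma true_poly_zero_power:
  assumes "\<phi> holomorphic_on UNIV" "h holomorphic_on UNIV" "\<phi> a = 0"
  shows "true_poly r (\<lambda>z. \<phi> z ^ r * h z) a = of_real (sqrt (pi ^ r / fact r)) * fact r * deriv \<phi> a ^ r * h a"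
proof -
  have hol: "(\<lambda>u. exp (- of_real pi * u * cnj a) * h u) holomorphic_on UNIV"
    using assms by (intro holomorphic_intros)
  have "- complex_of_real pi * a * cnj a = of_real (- pi * (cmod a)\<^sup>2)"
    by (simp only: of_real_mult of_real_minus complex_norm_square mult.assoc)
  hence e: "of_real (exp (pi * (cmod a)\<^sup>2)) * exp (- of_real pi * a * cnj a) = 1"
    by (simp only: exp_of_real flip: of_real_mult exp_add) simp
  have "true_poly r (\<lambda>z. \<phi> z ^ r * h z) a = of_real (sqrt (pi ^ r / fact r)) * of_real (exp (pi * (cmod a)\<^sup>2)) *
     (deriv ^^ r) (\<lambda>u. \<phi> u ^ r * (exp (- of_real pi * u * cnj a) * h u)) a"
    using assms by (subst true_poly_eq) (auto intro!: holomorphic_intros simp: algebra_simps)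
  also have "\<dots> = of_real (sqrt (pi ^ r / fact r)) * of_real (exp (pi * (cmod a)\<^sup>2)) *
      (fact r * deriv \<phi> a ^ r * (exp (- of_real pi * a * cnj a) * h a))"
    by (simp only: higher_deriv_power_mult_at_zero[OF assms(1) hol assms(3)])
  also have "\<dots> = of_real (sqrt (pi ^ r / fact r)) * fact r * deriv \<phi> a ^ r * h a * (of_real (exp (pi * (cmod a)\<^sup>2)) * exp (- of_real pi * a * cnj a))"
    by (simp only: mult_ac)
  finally show ?thesis unfolding e by simp
qed

section \<open>Infinite products and exponential lattice sums\<close>

text \<open>A countable product of entire functions. It is described by finite partial products over sets
  that exhaust \<open>J\<close>, the same for all \<open>z\<close>, so that zeros, periods and bounds of finite products pass to the limit
  whether \<open>J\<close> is finite or infinite.\<close>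

lemma infinite_product_entire:
  fixes u :: "'a \<Rightarrow> complex \<Rightarrow> complex"
  assumes J: "countable J" and hol: "\<And>j. j \<in> J \<Longrightarrow> u j holomorphic_on UNIV"
    and dom: "\<And>R. \<exists>M. M summable_on J \<and> (\<forall>j\<in>J. \<forall>z\<in>cball 0 R. cmod (u j z) \<le> M j)"
  obtains P and A :: "nat \<Rightarrow> 'a set" where "P holomorphic_on UNIV" "\<And>n. finite (A n)" "\<And>n. A n \<subseteq> J"
    "\<And>j. j \<in> J \<Longrightarrow> eventually (\<lambda>n. j \<in> A n) sequentially"
    "\<And>z. (\<lambda>n. \<Prod>j\<in>A n. 1 + u j z) \<longlonglongrightarrow> P z"
proof -
  obtain g :: "'a \<Rightarrow> nat" where g: "inj_on g J" using J unfolding countable_def by blast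
  define v where "v i = inv_into J g i" for i
  have v: "v (g j) = j" if "j \<in> J" for j using g that by (simp add: v_def)
  have vJ: "v i \<in> J" if "i \<in> g ` J" for i using that v by auto
  define f where "f i z = (if i \<in> g ` J then u (v i) z else 0)" for i z
  have fhol: "f i holomorphic_on S" for i S
    using holomorphic_on_subset[OF hol[OF vJ]] by (cases "i \<in> g ` J") (auto simp: f_def[abs_def])
  define A where "A n = {j \<in> J. g j < n}" for n
  have prodA: "(\<Prod>j\<in>A n. 1 + u j z) = (\<Prod>i<n. 1 + f i z)" for n z
  proof -
    have "(\<Prod>i<n. 1 + f i z) = (\<Prod>i\<in>g ` A n. 1 + f i z)"
      by (rule prod.mono_neutral_right) (auto simp: A_def f_def)
    also have "\<dots> = (\<Prod>j\<in>A n. 1 + f (g j) z)"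
      using g by (subst prod.reindex) (auto simp: A_def inj_on_def)
    also have "\<dots> = (\<Prod>j\<in>A n. 1 + u j z)"
      by (rule prod.cong) (auto simp: A_def f_def v)
    finally show ?thesis by simp
  qed
  have finA: "finite (A n)" for n
  proof -
    have "g ` A n \<subseteq> {..<n}" "inj_on g (A n)" using g by (auto simp: A_def inj_on_def)
    thus ?thesis using finite_imageD finite_subset by blast
  qed
  define P where "P z = lim (\<lambda>n. \<Prod>i<n. 1 + f i z)" for z
  have ulim: "uniform_limit (cball 0 R) (\<lambda>n z. \<Prod>i<n. 1 + f i z) P sequentially" for R
  proof -
    obtain M where M: "M summable_on J" "\<And>j z. j \<in> J \<Longrightarrow> z \<in> cball 0 R \<Longrightarrow> cmod (u j z) \<le> M j"
      using dom[of R] by blast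
    define M' where "M' i = (if i \<in> g ` J then M (v i) else 0)" for i
    have "(M' \<circ> g) summable_on J"
      using M(1) by (rule summable_on_cong[THEN iffD1, rotated]) (auto simp: M'_def v)
    hence "M' summable_on (g ` J)" using summable_on_reindex[OF g] by blast
    hence "M' summable_on UNIV"
      by (rule summable_on_cong_neutral[THEN iffD1, rotated -1]) (auto simp: M'_def)
    hence sM: "summable M'" by (rule summable_on_imp_summable)
    have bd: "norm (norm (f i z)) \<le> M' i" if "z \<in> cball 0 R" for i z
      using M(2)[OF vJ that] by (auto simp: f_def M'_def)
    have "uniformly_convergent_on (cball 0 R) (\<lambda>n z. \<Sum>i<n. norm (f i z))"
      by (rule Weierstrass_m_test'[OF bd sM])
    hence "uniformly_convergent_on (cball 0 R) (\<lambda>n z. \<Prod>i<n. 1 + f i z)"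
      by (intro uniformly_convergent_on_prod holomorphic_on_imp_continuous_on fhol) auto
    then show ?thesis unfolding uniformly_convergent_uniform_limit_iff P_def .
  qed
  have "P holomorphic_on UNIV"
  proof (rule holomorphic_uniform_sequence[of UNIV "\<lambda>n z. \<Prod>i<n. 1 + f i z"])
    show "(\<lambda>z. \<Prod>i<n. 1 + f i z) holomorphic_on UNIV" for n
      by (intro holomorphic_intros fhol)
    fix x :: complex
    have "cball x 1 \<subseteq> cball 0 (cmod x + 1)"
      by (simp add: cball_subset_cball_iff)
    thus "\<exists>d>0. cball x d \<subseteq> UNIV \<and> uniform_limit (cball x d) (\<lambda>n z. \<Prod>i<n. 1 + f i z) P sequentially"
      using uniform_limit_on_subset[OF ulim] by (intro exI[of _ 1]) auto
  qed auto
  moreover have "(\<lambda>n. \<Prod>j\<in>A n. 1 + u j z) \<longlonglongrightarrow> P z" for z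
    unfolding prodA using tendsto_uniform_limitI[OF ulim, of z "cmod z"] by simp
  moreover have "eventually (\<lambda>n. j \<in> A n) sequentially" if "j \<in> J" for j
    using eventually_gt_at_top[of "g j"] by eventually_elim (use that in \<open>auto simp: A_def\<close>)
  ultimately show thesis using that[of P A] finA by (auto simp: A_def)
qed

text \<open>Moving each \<open>s j\<close> down to the next multiple of \<open>\<rho>\<close> only increases the sum, and at most \<open>N\<close> of them
  end at the same multiple. So sums over irregular points are bounded by sums over a lattice.\<close>

lemma sum_antimono_le_lattice_sum:
  fixes s :: "'a \<Rightarrow> real" and f :: "real \<Rightarrow> real"
  assumes "finite A" "\<rho> > 0" and s: "\<And>j. j \<in> A \<Longrightarrow> 0 \<le> s j"
    and card: "\<And>m::nat. real (card {j \<in> A. m * \<rho> \<le> s j \<and> s j \<le> m * \<rho> + \<rho>}) \<le> N"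
    and f: "\<And>x y. x \<le> y \<Longrightarrow> f y \<le> f x" "\<And>x. 0 \<le> f x"
  obtains M where "(\<Sum>j\<in>A. f (s j)) \<le> N * (\<Sum>m<M. f (real m * \<rho>))"
proof -
  (* the multiple of \<rho> below s j, as an index *)
  define b where "b j = nat \<lfloor>s j / \<rho>\<rfloor>" for j
  define M where "M = Suc (Max (insert 0 (b ` A)))"
  have b: "real (b j) * \<rho> \<le> s j" "s j \<le> real (b j) * \<rho> + \<rho>" if "j \<in> A" for j
  proof -
    have "0 \<le> s j / \<rho>" using s[OF that] assms(2) by simp
    hence "real (b j) \<le> s j / \<rho>" "s j / \<rho> \<le> real (b j) + 1" unfolding b_def by linarith+
    thus "real (b j) * \<rho> \<le> s j" "s j \<le> real (b j) * \<rho> + \<rho>"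
      using assms(2) by (auto simp: field_simps)
  qed
  have bM: "b ` A \<subseteq> {..<M}" using assms(1) by (auto simp: M_def less_Suc_eq_le)
  have "(\<Sum>j\<in>A. f (s j)) \<le> (\<Sum>j\<in>A. f (real (b j) * \<rho>))"
    by (intro sum_mono f b)
  also have "\<dots> = (\<Sum>m<M. \<Sum>j\<in>{j\<in>A. b j = m}. f (real (b j) * \<rho>))"
    using sum.group[OF assms(1) finite_lessThan bM, of "\<lambda>j. f (real (b j) * \<rho>)"] by simp
  also have "\<dots> \<le> (\<Sum>m<M. N * f (real m * \<rho>))"
  proof (rule sum_mono)
    fix m
    have "card {j\<in>A. b j = m} \<le> card {j \<in> A. m * \<rho> \<le> s j \<and> s j \<le> m * \<rho> + \<rho>}"
      using assms(1) b by (intro card_mono) auto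
    hence "real (card {j\<in>A. b j = m}) \<le> N" using card[of m] by linarith
    moreover have "(\<Sum>j\<in>{j\<in>A. b j = m}. f (real (b j) * \<rho>)) = real (card {j\<in>A. b j = m}) * f (real m * \<rho>)"
      by simp
    ultimately show "(\<Sum>j\<in>{j\<in>A. b j = m}. f (real (b j) * \<rho>)) \<le> N * f (real m * \<rho>)"
      using f(2) mult_right_mono by metis
  qed
  finally show thesis using that by (simp add: sum_distrib_left)
qed

lemma sum_exp_lattice_le:
  assumes "c > (0::real)"
  shows "(\<Sum>m<M. exp (- (c * real m))) \<le> 1 / (1 - exp (- c))"
proof -
  have "(\<Sum>m<M. exp (- (c * real m))) = (\<Sum>m<M. exp (- c) ^ m)"
    by (simp add: exp_of_nat_mult[symmetric] mult.commute)
  also have "\<dots> \<le> (\<Sum>m. exp (- c) ^ m)"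
    using assms by (intro sum_le_suminf) (auto intro!: summable_geometric)
  also have "\<dots> = 1 / (1 - exp (- c))"
    using assms by (intro suminf_geometric) auto
  finally show ?thesis .
qed

text \<open>The product of the factors \<open>1 + exp (2 \<pi> (t - m \<rho>))\<close> behaves like a theta function: moving \<open>t\<close> by
  \<open>\<rho>\<close> reproduces it up to the factor with \<open>m = 0\<close>, which is comparable to \<open>exp (2 \<pi> t)\<close>. The quadratic
  \<open>\<pi> t\<^sup>2 / \<rho>\<close> has the increment \<open>2 \<pi> t\<close> under that shift up to a constant, which the linear term
  absorbs. This gives an induction on the number of factors.\<close>

lemma sum_ln_lattice_le:
  fixes \<rho> t :: real
  assumes "\<rho> > 0" "t \<ge> 0"
  shows "(\<Sum>m<M. ln (1 + exp (2 * pi * (t - real m * \<rho>))))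
    \<le> pi * t\<^sup>2 / \<rho> + (ln 2 / \<rho> + pi) * t + exp (2 * pi * \<rho>) / (1 - exp (- (2 * pi * \<rho>)))"
  using assms(2)
proof (induction M arbitrary: t)
  case 0
  then show ?case using assms(1) by (auto intro!: add_nonneg_nonneg)
next
  case (Suc M)
  let ?C = "exp (2 * pi * \<rho>) / (1 - exp (- (2 * pi * \<rho>)))"
  show ?case
  proof (cases "t \<le> \<rho>")
    case True
    have "(\<Sum>m<Suc M. ln (1 + exp (2 * pi * (t - real m * \<rho>)))) \<le>
        (\<Sum>m<Suc M. exp (2 * pi * \<rho>) * exp (- (2 * pi * \<rho> * real m)))"
    proof (rule sum_mono)
      fix m
      have "ln (1 + exp (2 * pi * (t - real m * \<rho>))) \<le> exp (2 * pi * (t - real m * \<rho>))"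
        by (rule ln_add_one_self_le_self) simp
      also have "\<dots> \<le> exp (2 * pi * \<rho> - 2 * pi * \<rho> * real m)"
        using True by (simp add: algebra_simps)
      finally show "ln (1 + exp (2 * pi * (t - real m * \<rho>))) \<le> exp (2 * pi * \<rho>) * exp (- (2 * pi * \<rho> * real m))"
        by (simp flip: exp_add)
    qed
    also have "\<dots> \<le> exp (2 * pi * \<rho>) * (1 / (1 - exp (- (2 * pi * \<rho>))))"
      unfolding sum_distrib_left[symmetric] using assms(1) by (intro mult_left_mono sum_exp_lattice_le) auto
    finally have "(\<Sum>m<Suc M. ln (1 + exp (2 * pi * (t - real m * \<rho>)))) \<le> ?C" by simp
    moreover have "0 \<le> pi * t\<^sup>2 / \<rho> + (ln 2 / \<rho> + pi) * t"
      using assms(1) Suc.prems by (auto intro!: add_nonneg_nonneg mult_nonneg_nonneg)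
    ultimately show ?thesis by linarith
  next
    case False
    have "(\<Sum>m<Suc M. ln (1 + exp (2 * pi * (t - real m * \<rho>)))) =
        ln (1 + exp (2 * pi * t)) + (\<Sum>m<M. ln (1 + exp (2 * pi * ((t - \<rho>) - real m * \<rho>))))"
      by (simp only: sum.lessThan_Suc_shift) (simp add: algebra_simps)
    moreover have "ln (1 + exp (2 * pi * t)) \<le> ln 2 + 2 * pi * t"
    proof -
      have "1 + exp (2 * pi * t) \<le> 2 * exp (2 * pi * t)" using Suc.prems by simp
      hence "ln (1 + exp (2 * pi * t)) \<le> ln (2 * exp (2 * pi * t))"
        by (subst ln_le_cancel_iff) (auto intro: add_pos_pos)
      thus ?thesis by (simp add: ln_mult)
    qed
    moreover have "(\<Sum>m<M. ln (1 + exp (2 * pi * ((t - \<rho>) - real m * \<rho>)))) \<le>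
        pi * (t - \<rho>)\<^sup>2 / \<rho> + (ln 2 / \<rho> + pi) * (t - \<rho>) + ?C"
      using False by (intro Suc.IH) auto
    moreover have "pi * (t - \<rho>)\<^sup>2 / \<rho> + (ln 2 / \<rho> + pi) * (t - \<rho>) = pi * t\<^sup>2 / \<rho> + (ln 2 / \<rho> + pi) * t - 2 * pi * t - ln 2"
      using assms(1) by (simp add: field_simps power2_eq_square)
    ultimately show ?thesis by linarith
  qed
qed

text \<open>Lower bound for the factors of a product at a point away from its zeros, in a form that multiplies:
  small \<open>w\<close> cost a factor \<open>exp (- 2 |w|)\<close>, and the large ones are paid for by \<open>\<eta>\<close>.\<close>

lemma norm_one_minus_ge_exp:
  fixes w :: complex
  assumes "cmod w \<le> 1" "\<eta> \<le> cmod (1 - w)" "0 < \<eta>" "\<eta> \<le> 1"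
  shows "exp (- ((2 + 2 * ln (1 / \<eta>)) * cmod w)) \<le> cmod (1 - w)"
proof (cases "cmod w \<le> 1 / 2")
  case True
  have "- cmod w - 2 * (cmod w)\<^sup>2 \<le> ln (1 - cmod w)"
    using True by (intro ln_one_minus_pos_lower_bound) auto
  moreover have "(cmod w)\<^sup>2 \<le> cmod w * (1 / 2)" unfolding power2_eq_square
    using True by (intro mult_left_mono) auto
  moreover have "0 \<le> ln (1 / \<eta>) * cmod w" using assms by simp
  ultimately have "- ((2 + 2 * ln (1 / \<eta>)) * cmod w) \<le> ln (1 - cmod w)"
    by (simp add: algebra_simps)
  hence "exp (- ((2 + 2 * ln (1 / \<eta>)) * cmod w)) \<le> exp (ln (1 - cmod w))" by simp
  also have "\<dots> = 1 - cmod w" using True by simp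
  also have "\<dots> \<le> cmod (1 - w)" using norm_triangle_ineq2[of 1 w] by simp
  finally show ?thesis .
next
  case False
  have "0 \<le> ln (1 / \<eta>)" using assms by simp
  hence "(2 + 2 * ln (1 / \<eta>)) * (1 / 2) \<le> (2 + 2 * ln (1 / \<eta>)) * cmod w"
    using False by (intro mult_left_mono) auto
  moreover have "ln (1 / \<eta>) = - ln \<eta>" using assms by (simp add: ln_div)
  ultimately have "- ((2 + 2 * ln (1 / \<eta>)) * cmod w) \<le> ln \<eta>" by (simp add: algebra_simps)
  hence "exp (- ((2 + 2 * ln (1 / \<eta>)) * cmod w)) \<le> exp (ln \<eta>)" by simp
  thus ?thesis using assms by simp
qed

text \<open>If \<open>exp (2 \<pi> \<i> \<zeta>)\<close> were close to 1, its logarithm would show \<open>\<zeta>\<close> close to an integer.\<close>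

lemma norm_one_minus_exp_ge:
  assumes "\<And>m::int. \<delta> \<le> cmod (\<zeta> + of_int m)"
  shows "min (1 / 3) \<delta> \<le> cmod (1 - exp (2 * of_real pi * \<i> * \<zeta>))"
proof (rule ccontr)
  assume neg: "\<not> min (1 / 3) \<delta> \<le> cmod (1 - exp (2 * of_real pi * \<i> * \<zeta>))"
  define y where "y = exp (2 * of_real pi * \<i> * \<zeta>) - 1"
  have y: "cmod y < 1 / 3" "cmod y < \<delta>"
    using neg by (auto simp: y_def norm_minus_commute)
  have "1 + y \<noteq> 0" by (simp add: y_def)
  hence "exp (2 * of_real pi * \<i> * \<zeta>) = exp (Ln (1 + y))" by (simp add: y_def)
  then obtain n :: int where n: "2 * of_real pi * \<i> * \<zeta> = Ln (1 + y) + (of_int (2 * n) * of_real pi) * \<i>"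
    by (auto simp: exp_eq)
  hence "2 * of_real pi * \<i> * (\<zeta> + of_int (- n)) = Ln (1 + y)"
    by (simp add: algebra_simps)
  hence "cmod (2 * of_real pi * \<i> * (\<zeta> + of_int (- n))) = cmod (Ln (1 + y))" by simp
  also have "\<dots> \<le> 2 * cmod y" using y by (intro norm_Ln_le) auto
  finally have "2 * pi * cmod (\<zeta> + of_int (- n)) \<le> 2 * cmod y"
    by (simp only: norm_mult) simp
  moreover have "1 * cmod (\<zeta> + of_int (- n)) \<le> pi * cmod (\<zeta> + of_int (- n))"
    using pi_ge_two by (intro mult_right_mono) auto
  ultimately show False using assms[of "- n"] y by linarith
qed

section \<open>Points of bounded density in the cylinder\<close>

text \<open>At most \<open>N\<close> points in every closed slab of height \<open>\<rho>\<close>, and mutual distances at least \<open>\<delta>\<close> in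
  \<open>\<complex>/\<int>\<close>. Counting at one fixed height \<open>\<rho>\<close> replaces the density, which is then \<open>N / \<rho>\<close>.\<close>

locale sparse_points =
  fixes Z :: "complex set" and \<rho> N \<delta> :: real
  assumes \<rho>_pos: "\<rho> > 0"
    and finite_slab: "finite {z \<in> Z. a \<le> Im z \<and> Im z \<le> a + \<rho>}"
    and card_slab: "real (card {z \<in> Z. a \<le> Im z \<and> Im z \<le> a + \<rho>}) \<le> N"
    and \<delta>_pos: "\<delta> > 0"
    and separation: "z \<in> Z \<Longrightarrow> w \<in> Z \<Longrightarrow> z \<noteq> w \<Longrightarrow> \<delta> \<le> cmod (z - w + of_int m)"
begin

lemma N_nonneg: "N \<ge> 0"
  using card_slab[of 0] by linarith

lemma countable_Z: "countable Z"
proof -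
  have "Z \<subseteq> (\<Union>n::int. {z \<in> Z. n * \<rho> \<le> Im z \<and> Im z \<le> n * \<rho> + \<rho>})"
  proof
    fix z assume "z \<in> Z"
    have "of_int \<lfloor>Im z / \<rho>\<rfloor> * \<rho> \<le> Im z \<and> Im z \<le> of_int \<lfloor>Im z / \<rho>\<rfloor> * \<rho> + \<rho>"
      using floor_divide_lower[OF \<rho>_pos, of "Im z"] floor_divide_upper[OF \<rho>_pos, of "Im z"]
      by (simp add: algebra_simps)
    thus "z \<in> (\<Union>n::int. {z \<in> Z. n * \<rho> \<le> Im z \<and> Im z \<le> n * \<rho> + \<rho>})" using \<open>z \<in> Z\<close> by blast
  qed
  moreover have "countable (\<Union>n::int. {z \<in> Z. n * \<rho> \<le> Im z \<and> Im z \<le> n * \<rho> + \<rho>})"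
    using finite_slab by (intro countable_UN) (auto intro: countable_finite)
  ultimately show ?thesis using countable_subset by blast
qed

text \<open>The sign \<open>\<sigma>\<close> selects the points above or below the height \<open>y\<close>.\<close>

lemma one_sided_sum:
  fixes f :: "real \<Rightarrow> real"
  assumes "finite A" "A \<subseteq> Z" "\<sigma> = 1 \<or> \<sigma> = -1" "\<And>j. j \<in> A \<Longrightarrow> 0 \<le> \<sigma> * (Im j - y)"
    and f: "\<And>x y. x \<le> y \<Longrightarrow> f y \<le> f x" "\<And>x. 0 \<le> f x"
  obtains M where "(\<Sum>j\<in>A. f (\<sigma> * (Im j - y))) \<le> N * (\<Sum>m<M. f (real m * \<rho>))"
proof (rule sum_antimono_le_lattice_sum[OF assms(1) \<rho>_pos assms(4) _ f])
  fix m :: nat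
  define a where "a = (if \<sigma> = 1 then y + m * \<rho> else y - m * \<rho> - \<rho>)"
  have "{j \<in> A. m * \<rho> \<le> \<sigma> * (Im j - y) \<and> \<sigma> * (Im j - y) \<le> m * \<rho> + \<rho>} \<subseteq> {z \<in> Z. a \<le> Im z \<and> Im z \<le> a + \<rho>}"
    using assms(2,3) by (auto simp: a_def)
  hence "card {j \<in> A. m * \<rho> \<le> \<sigma> * (Im j - y) \<and> \<sigma> * (Im j - y) \<le> m * \<rho> + \<rho>} \<le> card {z \<in> Z. a \<le> Im z \<and> Im z \<le> a + \<rho>}"
    by (intro card_mono finite_slab)
  thus "real (card {j \<in> A. m * \<rho> \<le> \<sigma> * (Im j - y) \<and> \<sigma> * (Im j - y) \<le> m * \<rho> + \<rho>}) \<le> N"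
    using card_slab[of a] by linarith
qed

text \<open>Bounds the sum of \<open>exp (- c |Im j - y|)\<close> over the points, uniformly in \<open>y\<close>.\<close>

definition expsum :: "real \<Rightarrow> real" where
  "expsum c = 2 * N / (1 - exp (- (c * \<rho>)))"

lemma expsum_nonneg: "c > 0 \<Longrightarrow> expsum c \<ge> 0"
  using N_nonneg \<rho>_pos by (simp add: expsum_def)

lemma sum_exp_dist_le:
  assumes "finite A" "A \<subseteq> Z" "c > 0"
  shows "(\<Sum>j\<in>A. exp (- (c * \<bar>Im j - y\<bar>))) \<le> expsum c"
proof -
  have side: "(\<Sum>j\<in>B. exp (- (c * (\<sigma> * (Im j - y))))) \<le> N / (1 - exp (- (c * \<rho>)))"
    if BA: "B \<subseteq> A" and \<sigma>: "\<sigma> = 1 \<or> \<sigma> = -1" "\<And>j. j \<in> B \<Longrightarrow> 0 \<le> \<sigma> * (Im j - y)" for B \<sigma>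
  proof -
    have B: "finite B" "B \<subseteq> Z" using BA assms finite_subset by auto
    obtain M where "(\<Sum>j\<in>B. exp (- (c * (\<sigma> * (Im j - y))))) \<le> N * (\<Sum>m<M. exp (- (c * (real m * \<rho>))))"
      using one_sided_sum[OF B \<sigma>, of "\<lambda>x. exp (- (c * x))"] assms(3)
      by (metis (no_types, lifting) exp_ge_zero exp_le_cancel_iff mult_le_cancel_left_pos neg_le_iff_le)
    moreover have "N * (\<Sum>m<M. exp (- (c * (real m * \<rho>)))) \<le> N * (1 / (1 - exp (- (c * \<rho>))))"
      using sum_exp_lattice_le[of "c * \<rho>" M] assms(3) \<rho>_pos N_nonneg
      by (intro mult_left_mono) (auto simp: mult_ac)
    ultimately show ?thesis by simp
  qed
  have "(\<Sum>j\<in>A. exp (- (c * \<bar>Im j - y\<bar>))) =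
      (\<Sum>j\<in>{j\<in>A. y < Im j}. exp (- (c * \<bar>Im j - y\<bar>))) + (\<Sum>j\<in>{j\<in>A. \<not> y < Im j}. exp (- (c * \<bar>Im j - y\<bar>)))"
    using assms(1) by (subst sum.union_disjoint[symmetric]) (auto intro!: sum.cong)
  also have "(\<Sum>j\<in>{j\<in>A. y < Im j}. exp (- (c * \<bar>Im j - y\<bar>))) = (\<Sum>j\<in>{j\<in>A. y < Im j}. exp (- (c * (1 * (Im j - y)))))"
    by (intro sum.cong) auto
  also have "(\<Sum>j\<in>{j\<in>A. \<not> y < Im j}. exp (- (c * \<bar>Im j - y\<bar>))) = (\<Sum>j\<in>{j\<in>A. \<not> y < Im j}. exp (- (c * (-1 * (Im j - y)))))"
    by (intro sum.cong) auto
  finally show ?thesis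
    using side[of "{j\<in>A. y < Im j}" 1] side[of "{j\<in>A. \<not> y < Im j}" "-1"]
    by (auto simp: expsum_def)
qed

lemma summable_exp_dist: "c > 0 \<Longrightarrow> (\<lambda>j. exp (- (c * \<bar>Im j - y\<bar>))) summable_on Z"
  by (rule nonneg_bounded_partial_sums_imp_summable_on[where C = "expsum c"])
     (auto intro!: eventually_finite_subsets_at_top_weakI sum_exp_dist_le)

text \<open>Exponent of the bound for a product of factors \<open>1 + exp (2 \<pi> (T - s))\<close>, where \<open>s\<close> runs over the distances
  from a given height to the points on one side of it. Its leading coefficient is \<open>\<pi>\<close> times the density \<open>N / \<rho>\<close>.\<close>

definition growth :: "real \<Rightarrow> real" where
  "growth T = N * (pi * T\<^sup>2 / \<rho> + (ln 2 / \<rho> + pi) * T + exp (2 * pi * \<rho>) / (1 - exp (- (2 * pi * \<rho>))))"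

text \<open>The comparison with a lattice, applied to the logarithms of the factors.\<close>

lemma one_sided_prod_le:
  assumes "finite A" "A \<subseteq> Z" "\<sigma> = 1 \<or> \<sigma> = -1" "\<And>j. j \<in> A \<Longrightarrow> 0 \<le> \<sigma> * (Im j - y)" "t \<le> T" "0 \<le> T"
  shows "(\<Prod>j\<in>A. 1 + exp (2 * pi * (t - \<sigma> * (Im j - y)))) \<le> exp (growth T)"
proof -
  let ?f = "\<lambda>x. ln (1 + exp (2 * pi * (T - x)))"
  have "?f y \<le> ?f x" if "x \<le> y" for x y
    using that by (subst ln_le_cancel_iff) (auto intro: add_pos_pos)
  moreover have "0 \<le> ?f x" for x by simp
  ultimately obtain M where M: "(\<Sum>j\<in>A. ?f (\<sigma> * (Im j - y))) \<le> N * (\<Sum>m<M. ?f (real m * \<rho>))"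
    using one_sided_sum[OF assms(1-4), of ?f] by blast
  also have "\<dots> \<le> growth T" unfolding growth_def
    using N_nonneg \<rho>_pos assms by (intro mult_left_mono sum_ln_lattice_le) auto
  finally have S: "(\<Sum>j\<in>A. ?f (\<sigma> * (Im j - y))) \<le> growth T" .
  have "(\<Prod>j\<in>A. 1 + exp (2 * pi * (t - \<sigma> * (Im j - y)))) \<le> (\<Prod>j\<in>A. exp (?f (\<sigma> * (Im j - y))))"
  proof (rule prod_mono)
    fix j
    have "0 < 1 + exp (2 * pi * (T - \<sigma> * (Im j - y)))" by (simp add: add_pos_pos)
    thus "0 \<le> 1 + exp (2 * pi * (t - \<sigma> * (Im j - y))) \<and>
       1 + exp (2 * pi * (t - \<sigma> * (Im j - y))) \<le> exp (?f (\<sigma> * (Im j - y)))"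
      using assms(5) by (simp add: add_nonneg_nonneg)
  qed
  also have "\<dots> = exp (\<Sum>j\<in>A. ?f (\<sigma> * (Im j - y)))"
    by (simp only: exp_sum[OF assms(1)])
  also have "\<dots> \<le> exp (growth T)" using S by simp
  finally show ?thesis .
qed

text \<open>Lower bound for a product over the other points at a point of \<open>Z\<close>.\<close>

definition peak :: real where
  "peak = exp (- ((2 + 2 * ln (1 / min (1 / 3) \<delta>)) * expsum (2 * pi)))"

lemma peak_pos: "peak > 0" by (simp add: peak_def)

text \<open>For the points not above \<open>k\<close> the factor tends to 1 at the upper end of the cylinder, for the others
  at the lower end. Hence at a height above \<open>k\<close> only the points above \<open>k\<close> contribute to the growth, and
  symmetrically below; the other side contributes the constant \<open>growth 0\<close>. Counting both sides
  together would double the quadratic term and spoil the sharp density.\<close>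

lemma ex_punctured_product:
  assumes k: "k \<in> Z"
  obtains P where "P holomorphic_on UNIV" "\<And>z m. P (z + of_int m) = P z"
    "\<And>j. j \<in> Z \<Longrightarrow> j \<noteq> k \<Longrightarrow> P j = 0" "peak \<le> cmod (P k)"
    "\<And>z. cmod (P z) \<le> exp (growth \<bar>Im z - Im k\<bar> + growth 0)"
proof -
  define \<sigma> :: "complex \<Rightarrow> real" where "\<sigma> j = (if Im j \<le> Im k then 1 else -1)" for j
  define u where "u j z = - exp (2 * of_real pi * \<i> * (of_real (\<sigma> j) * (z - j)))" for j z
  have nu: "cmod (u j z) = exp (2 * pi * (\<sigma> j * (Im j - Im z)))" for j z
    by (simp add: u_def norm_exp_eq_Re algebra_simps)
  have nu_le: "cmod (u j z) \<le> exp (2 * pi * \<bar>Im z - Im k\<bar>) * exp (- (2 * pi * \<bar>Im j - Im k\<bar>))" for j z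
  proof -
    have "\<sigma> j * (Im j - Im z) \<le> \<bar>Im z - Im k\<bar> - \<bar>Im j - Im k\<bar>" by (simp add: \<sigma>_def) linarith
    hence "2 * pi * (\<sigma> j * (Im j - Im z)) \<le> 2 * pi * (\<bar>Im z - Im k\<bar> - \<bar>Im j - Im k\<bar>)"
      by (intro mult_left_mono) auto
    thus ?thesis unfolding nu by (simp flip: exp_add add: right_diff_distrib)
  qed
  obtain P A where P: "P holomorphic_on UNIV" and A: "\<And>n::nat. finite (A n)" "\<And>n. A n \<subseteq> Z - {k}"
    "\<And>j. j \<in> Z - {k} \<Longrightarrow> eventually (\<lambda>n. j \<in> A n) sequentially"
    "\<And>z. (\<lambda>n. \<Prod>j\<in>A n. 1 + u j z) \<longlonglongrightarrow> P z"
  proof (rule infinite_product_entire[of "Z - {k}" u])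
    show "countable (Z - {k})" using countable_Z by (rule countable_subset[rotated]) auto
    show "u j holomorphic_on UNIV" for j
      unfolding u_def[abs_def] by (intro holomorphic_intros)
    fix R :: real
    let ?M = "\<lambda>j. exp (2 * pi * (R + \<bar>Im k\<bar>)) * exp (- (2 * pi * \<bar>Im j - Im k\<bar>))"
    have "?M summable_on (Z - {k})"
      by (intro summable_on_cmult_right summable_on_subset[OF summable_exp_dist]) auto
    moreover have "cmod (u j z) \<le> ?M j" if "z \<in> cball 0 R" for j z
    proof -
      have "\<bar>Im z\<bar> \<le> R" using that abs_Im_le_cmod[of z] by simp
      hence "exp (2 * pi * \<bar>Im z - Im k\<bar>) \<le> exp (2 * pi * (R + \<bar>Im k\<bar>))" by simp
      thus ?thesis using nu_le[of j z] by (meson exp_ge_zero mult_right_mono order_trans)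
    qed
    ultimately show "\<exists>M. M summable_on (Z - {k}) \<and> (\<forall>j\<in>Z - {k}. \<forall>z\<in>cball 0 R. cmod (u j z) \<le> M j)"
      by blast
  qed blast
  show thesis
  proof (rule that[of P])
    fix z :: complex and m :: int
    have "u j (z + of_int m) = u j z" for j
    proof -
      have "2 * of_real pi * \<i> * (of_real (\<sigma> j) * (z + of_int m - j)) =
        2 * of_real pi * \<i> * (of_real (\<sigma> j) * (z - j)) + 2 * of_real pi * \<i> * of_int (if Im j \<le> Im k then m else - m)"
        by (auto simp: \<sigma>_def algebra_simps)
      moreover have "exp (2 * of_real pi * \<i> * of_int n) = 1" for n :: int
        using exp_integer_2pi[of "of_int n"] by (simp add: mult_ac)
      ultimately show ?thesis by (simp add: u_def exp_add)
    qed
    hence "(\<lambda>n. \<Prod>j\<in>A n. 1 + u j z) \<longlonglongrightarrow> P (z + of_int m)" using A(4)[of "z + of_int m"] by simp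
    thus "P (z + of_int m) = P z" using A(4) LIMSEQ_unique by blast
  next
    fix j assume "j \<in> Z" "j \<noteq> k"
    hence "eventually (\<lambda>n. j \<in> A n) sequentially" using A(3) by blast
    hence "eventually (\<lambda>n. (\<Prod>i\<in>A n. 1 + u i j) = 0) sequentially"
    proof eventually_elim
      case (elim n)
      moreover have "1 + u j j = 0" by (simp add: u_def)
      ultimately show ?case using A(1) by (auto intro!: prod_zero)
    qed
    hence "(\<lambda>n. \<Prod>i\<in>A n. 1 + u i j) \<longlonglongrightarrow> 0" by (simp add: tendsto_eventually)
    thus "P j = 0" using A(4) LIMSEQ_unique by blast
  next
    have "peak \<le> cmod (\<Prod>j\<in>A n. 1 + u j k)" for n
    proof -
      let ?\<eta> = "min (1 / 3) \<delta>"
      let ?K = "2 + 2 * ln (1 / ?\<eta>)"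
      have \<eta>: "0 < ?\<eta>" "?\<eta> \<le> 1" using \<delta>_pos by auto
      have K: "0 \<le> ?K" using \<eta> by (simp add: ln_div)
      have nuk: "cmod (u j k) = exp (- (2 * pi * \<bar>Im j - Im k\<bar>))" for j
      proof -
        have "\<sigma> j * (Im j - Im k) = - \<bar>Im j - Im k\<bar>" unfolding \<sigma>_def by (cases "Im j \<le> Im k") auto
        thus ?thesis unfolding nu by (simp only: mult_minus_right)
      qed
      have "?\<eta> \<le> cmod (1 - - u j k)" if "j \<in> A n" for j
      proof -
        have j: "j \<in> Z" "j \<noteq> k" using that A(2) by auto
        have "\<delta> \<le> cmod (of_real (\<sigma> j) * (k - j) + of_int m)" for m
          using separation[OF k j(1), of m] separation[OF j(1) k, of m] j(2) by (auto simp: \<sigma>_def)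
        from norm_one_minus_exp_ge[OF this] show ?thesis by (simp add: u_def)
      qed
      from norm_one_minus_ge_exp[OF _ this \<eta>]
      have 1: "exp (- (?K * cmod (u j k))) \<le> cmod (1 + u j k)" if "j \<in> A n" for j
        using that by (simp add: nuk)
      have "(\<Sum>j\<in>A n. cmod (u j k)) \<le> expsum (2 * pi)"
        unfolding nuk using A by (intro sum_exp_dist_le) auto
      hence "?K * (\<Sum>j\<in>A n. cmod (u j k)) \<le> ?K * expsum (2 * pi)" using K by (rule mult_left_mono)
      hence "peak \<le> exp (\<Sum>j\<in>A n. - (?K * cmod (u j k)))"
        unfolding peak_def by (simp add: sum_negf sum_distrib_left)
      also have "\<dots> = (\<Prod>j\<in>A n. exp (- (?K * cmod (u j k))))" using A(1) by (rule exp_sum)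
      also have "\<dots> \<le> (\<Prod>j\<in>A n. cmod (1 + u j k))" using 1 by (intro prod_mono) auto
      finally show ?thesis by (simp add: prod_norm)
    qed
    thus "peak \<le> cmod (P k)"
      using tendsto_lowerbound[OF tendsto_norm[OF A(4)[of k]]] by auto
  next
    fix z
    define t where "t = Im z - Im k"
    have "cmod (\<Prod>j\<in>A n. 1 + u j z) \<le> exp (growth \<bar>t\<bar> + growth 0)" for n
    proof -
      let ?L = "{j \<in> A n. Im j \<le> Im k}" and ?H = "{j \<in> A n. \<not> Im j \<le> Im k}"
      have sub: "finite ?L" "finite ?H" "?L \<subseteq> Z" "?H \<subseteq> Z" using A(1,2) by auto
      have "cmod (\<Prod>j\<in>A n. 1 + u j z) \<le> (\<Prod>j\<in>A n. 1 + cmod (u j z))"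
        unfolding prod_norm[symmetric] by (intro prod_mono) (auto intro: order_trans[OF norm_triangle_ineq])
      also have "\<dots> = (\<Prod>j\<in>?L. 1 + cmod (u j z)) * (\<Prod>j\<in>?H. 1 + cmod (u j z))"
        using A(1) by (subst prod.union_disjoint[symmetric]) (auto intro!: prod.cong)
      also have "(\<Prod>j\<in>?L. 1 + cmod (u j z)) = (\<Prod>j\<in>?L. 1 + exp (2 * pi * (- t - (-1) * (Im j - Im k))))"
        by (intro prod.cong) (auto simp: nu \<sigma>_def t_def)
      also have "(\<Prod>j\<in>?H. 1 + cmod (u j z)) = (\<Prod>j\<in>?H. 1 + exp (2 * pi * (t - 1 * (Im j - Im k))))"
        by (intro prod.cong) (auto simp: nu \<sigma>_def t_def)
      also have "(\<Prod>j\<in>?L. 1 + exp (2 * pi * (- t - (-1) * (Im j - Im k)))) * (\<Prod>j\<in>?H. 1 + exp (2 * pi * (t - 1 * (Im j - Im k))))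
         \<le> exp (growth (max 0 (- t))) * exp (growth (max 0 t))"
        by (intro mult_mono one_sided_prod_le sub prod_nonneg) (auto intro: add_nonneg_nonneg)
      also have "\<dots> = exp (growth \<bar>t\<bar> + growth 0)"
        by (simp flip: exp_add add: max_def)
      finally show ?thesis .
    qed
    thus "cmod (P z) \<le> exp (growth \<bar>Im z - Im k\<bar> + growth 0)"
      unfolding t_def[symmetric] using tendsto_upperbound[OF tendsto_norm[OF A(4)[of z]]] by auto
  qed (rule P)
qed

end

section \<open>Fundamental functions of interpolation\<close>

context sparse_points
begin

text \<open>The constant \<open>C\<close> is a parameter because interpolation needs the same one for all points.\<close>

definition fundamental_function :: "real \<Rightarrow> nat \<Rightarrow> real \<Rightarrow> complex \<Rightarrow> (complex \<Rightarrow> complex) \<Rightarrow> bool" where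
  "fundamental_function \<nu> r C k B \<longleftrightarrow>
      B holomorphic_on UNIV \<and> quasi_periodic \<nu> B \<and>
      (\<forall>j\<in>Z. true_poly r B j = (if j = k then 1 else 0)) \<and>
      (\<forall>z. cmod (B z) * exp (- pi / 2 * (cmod z)\<^sup>2) \<le> C * exp (- pi / 2 * (cmod k)\<^sup>2) * exp (- \<bar>Im k - Im z\<bar>))"

text \<open>The function described at the beginning, divided by its value under \<^const>\<open>true_poly\<close> at \<open>k\<close>. Its
  modulus is governed by \<open>- \<pi> t\<^sup>2 + (r + 1) \<pi> N t\<^sup>2 / \<rho>\<close>, with \<open>t = Im z - Im k\<close> and \<open>N / \<rho>\<close> the density, plus
  terms linear in \<open>|t|\<close>; the exponential decay asked for is another such linear term.\<close>

lemma ex_fundamental_function: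
  fixes r :: nat
  assumes sparse: "(real r + 1) * N < \<rho>"
  shows "\<exists>C>0. \<forall>k\<in>Z. \<exists>B. fundamental_function \<nu> r C k B"
proof -
  define c\<^sub>1 c\<^sub>2 where "c\<^sub>1 = ln 2 / \<rho> + pi" and "c\<^sub>2 = exp (2 * pi * \<rho>) / (1 - exp (- (2 * pi * \<rho>)))"
  have growth: "growth T = N * (pi * T\<^sup>2 / \<rho> + c\<^sub>1 * T + c\<^sub>2)" for T
    by (simp add: growth_def c\<^sub>1_def c\<^sub>2_def)
  define \<alpha> \<beta> where "\<alpha> = pi * (1 - (real r + 1) * N / \<rho>)"
    and "\<beta> = 2 * pi + 2 * pi * r + (real r + 1) * N * c\<^sub>1 + 1"
  have "(real r + 1) * N / \<rho> < 1" using sparse \<rho>_pos by simp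
  hence \<alpha>: "\<alpha> > 0" unfolding \<alpha>_def by (intro mult_pos_pos) auto
  define L where "L = r * ln 2 + 2 * (real r + 1) * N * c\<^sub>2 + \<beta>\<^sup>2 / (4 * \<alpha>)"
  have exponent: "- pi * t\<^sup>2 + 2 * pi * \<bar>t\<bar> + r * (ln 2 + 2 * pi * \<bar>t\<bar>) + (real r + 1) * (growth \<bar>t\<bar> + growth 0) \<le> L - \<bar>t\<bar>" for t
  proof -
    have "- pi * t\<^sup>2 + 2 * pi * \<bar>t\<bar> + r * (ln 2 + 2 * pi * \<bar>t\<bar>) + (real r + 1) * (growth \<bar>t\<bar> + growth 0)
        = - \<alpha> * \<bar>t\<bar>\<^sup>2 + \<beta> * \<bar>t\<bar> - \<bar>t\<bar> + (r * ln 2 + 2 * (real r + 1) * N * c\<^sub>2)"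
      using \<rho>_pos by (simp add: growth \<alpha>_def \<beta>_def field_simps)
    (* completing the square absorbs every linear term, \<bar>t\<bar> included *)
    also have "- \<alpha> * \<bar>t\<bar>\<^sup>2 + \<beta> * \<bar>t\<bar> = \<beta>\<^sup>2 / (4 * \<alpha>) - \<alpha> * (\<bar>t\<bar> - \<beta> / (2 * \<alpha>))\<^sup>2"
      using \<alpha> by (simp add: field_simps power2_eq_square)
    also have "\<dots> \<le> \<beta>\<^sup>2 / (4 * \<alpha>)" using \<alpha> by simp
    finally show ?thesis by (simp add: L_def)
  qed
  define c\<^sub>0 where "c\<^sub>0 = sqrt (pi ^ r / fact r) * fact r * (2 * pi) ^ r"
  have c\<^sub>0: "c\<^sub>0 > 0" by (simp add: c\<^sub>0_def)
  define D where "D = 1 / (c\<^sub>0 * peak ^ Suc r)"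
  have D: "D > 0" using c\<^sub>0 peak_pos by (simp add: D_def)
  show ?thesis
  proof (intro exI[of _ "D * exp L"] conjI ballI)
    show "D * exp L > 0" using D by simp
    fix k assume k: "k \<in> Z"
    obtain P where P: "P holomorphic_on UNIV" "\<And>z m. P (z + of_int m) = P z"
      "\<And>j. j \<in> Z \<Longrightarrow> j \<noteq> k \<Longrightarrow> P j = 0" "peak \<le> cmod (P k)"
      "\<And>z. cmod (P z) \<le> exp (growth \<bar>Im z - Im k\<bar> + growth 0)"
      using ex_punctured_product[OF k] by metis
    have Pk: "P k \<noteq> 0" using P(4) peak_pos by auto
    (* centres the Gaussian at the height of k; the floor costs a factor exp (2 \<pi> |t|) *)
    define n where "n = \<lfloor>- Im k - \<nu>\<rfloor>"
    define a where "a = of_int n + \<nu>"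
    have a: "\<bar>a + Im k\<bar> \<le> 1" unfolding a_def n_def by linarith
    define E where "E z = exp (of_real pi / 2 * z\<^sup>2 + 2 * of_real pi * \<i> * of_real a * (z - k))" for z
    define \<phi> where "\<phi> z = 1 - exp (2 * of_real pi * \<i> * (z - k))" for z
    have hol: "E holomorphic_on UNIV" "\<phi> holomorphic_on UNIV"
      unfolding E_def[abs_def] \<phi>_def[abs_def] by (intro holomorphic_intros; simp)+
    have \<phi>k: "\<phi> k = 0" "deriv \<phi> k = - (2 * of_real pi * \<i>)"
      unfolding \<phi>_def[abs_def] by (simp, rule DERIV_imp_deriv, auto intro!: derivative_eq_intros)
    define v where "v = of_real (sqrt (pi ^ r / fact r)) * fact r * (- (2 * of_real pi * \<i>)) ^ r * (E k * P k ^ Suc r)"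
    define B where "B z = inverse v * (E z * \<phi> z ^ r * P z ^ Suc r)" for z
    have Ek: "cmod (E k) = exp (pi / 2 * (cmod k)\<^sup>2) * exp (- (pi * (Im k)\<^sup>2))"
    proof -
      have "cmod (E k) = exp (pi / 2 * ((Re k)\<^sup>2 - (Im k)\<^sup>2))"
        by (simp add: E_def norm_exp_eq_Re power2_eq_square)
      also have "pi / 2 * ((Re k)\<^sup>2 - (Im k)\<^sup>2) = pi / 2 * (cmod k)\<^sup>2 + - (pi * (Im k)\<^sup>2)"
        by (simp add: cmod_power2 algebra_simps)
      finally show ?thesis by (simp only: exp_add)
    qed
    have nv: "cmod v = c\<^sub>0 * (cmod (E k) * cmod (P k) ^ Suc r)"
      by (simp add: v_def c\<^sub>0_def norm_mult norm_power)
    have v0: "v \<noteq> 0" using Pk c\<^sub>0 nv Ek by (metis exp_gt_zero mult_eq_0_iff norm_eq_zero order_less_irrefl power_not_zero)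
    have inv_v: "inverse (cmod v) \<le> D * exp (- pi / 2 * (cmod k)\<^sup>2) * exp (pi * (Im k)\<^sup>2)"
    proof -
      have "c\<^sub>0 * (cmod (E k) * peak ^ Suc r) \<le> cmod v"
        unfolding nv using P(4) peak_pos c\<^sub>0 by (intro mult_left_mono power_mono) auto
      moreover have "0 < c\<^sub>0 * (cmod (E k) * peak ^ Suc r)"
        using c\<^sub>0 peak_pos by (simp add: Ek)
      ultimately have "inverse (cmod v) \<le> inverse (c\<^sub>0 * (cmod (E k) * peak ^ Suc r))"
        by (rule le_imp_inverse_le)
      also have "\<dots> = D * exp (- pi / 2 * (cmod k)\<^sup>2) * exp (pi * (Im k)\<^sup>2)"
        by (simp add: D_def Ek exp_minus field_simps)
      finally show ?thesis .
    qed
    have "B holomorphic_on UNIV"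
      unfolding B_def[abs_def] by (intro holomorphic_intros hol P)
    moreover have "quasi_periodic \<nu> B"
      unfolding quasi_periodic_def
    proof (intro allI)
      fix z :: complex and m :: int
      have e1: "exp (2 * of_real pi * \<i> * of_int l) = 1" for l :: int
        using exp_integer_2pi[of "of_int l"] by (simp add: mult_ac)
      have "2 * of_real pi * \<i> * (z + of_int m - k) = 2 * of_real pi * \<i> * (z - k) + 2 * of_real pi * \<i> * of_int m"
        by (simp add: algebra_simps)
      hence "\<phi> (z + of_int m) = \<phi> z" by (simp only: \<phi>_def exp_add e1 mult_1_right)
      moreover have "E (z + of_int m) = exp (2 * of_real pi * \<i> * of_int m * of_real \<nu>) *
        exp (of_real pi / 2 * (of_int m)\<^sup>2 + of_real pi * z * of_int m) * E z"
      proof -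
        have "of_real pi / 2 * (z + of_int m)\<^sup>2 + 2 * of_real pi * \<i> * of_real a * (z + of_int m - k) =
          2 * of_real pi * \<i> * of_int m * of_real \<nu> + (of_real pi / 2 * (of_int m)\<^sup>2 + of_real pi * z * of_int m)
          + (of_real pi / 2 * z\<^sup>2 + 2 * of_real pi * \<i> * of_real a * (z - k)) + 2 * of_real pi * \<i> * of_int (n * m)"
          by (simp add: a_def power2_eq_square field_simps)
        thus ?thesis by (simp only: E_def exp_add e1 mult_1_right)
      qed
      ultimately show "B (z + of_int m) = exp (2 * of_real pi * \<i> * of_int m * of_real \<nu>) *
        exp (of_real pi / 2 * (of_int m)\<^sup>2 + of_real pi * z * of_int m) * B z"
        by (simp add: B_def P(2))
    qed
    moreover have "true_poly r B j = (if j = k then 1 else 0)" if j: "j \<in> Z" for j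
    proof (cases "j = k")
      case True
      have "true_poly r B k = true_poly r (\<lambda>z. \<phi> z ^ r * (inverse v * (E z * P z ^ Suc r))) k"
        by (simp add: B_def[abs_def] mult_ac)
      also have "\<dots> = inverse v * v"
        by (subst true_poly_zero_power) (auto intro!: holomorphic_intros hol P simp: \<phi>k v_def)
      finally show ?thesis using True v0 by simp
    next
      case False
      have "true_poly r B j = true_poly r (\<lambda>z. P z ^ r * (inverse v * (E z * \<phi> z ^ r * P z))) j"
        by (simp add: B_def[abs_def] mult_ac)
      also have "\<dots> = 0"
        by (subst true_poly_zero_power) (use P(3)[OF j False] in \<open>auto intro!: holomorphic_intros hol P\<close>)
      finally show ?thesis using False by simp
    qed
    moreover have "cmod (B z) * exp (- pi / 2 * (cmod z)\<^sup>2) \<le> D * exp L * exp (- pi / 2 * (cmod k)\<^sup>2) * exp (- \<bar>Im k - Im z\<bar>)" for z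
    proof -
      define t where "t = Im z - Im k"
      have 1: "cmod (E z) * exp (- pi / 2 * (cmod z)\<^sup>2) \<le> exp (- (pi * (Im k)\<^sup>2)) * exp (- pi * t\<^sup>2 + 2 * pi * \<bar>t\<bar>)"
      proof -
        have "cmod (E z) = exp (pi / 2 * ((Re z)\<^sup>2 - (Im z)\<^sup>2) - 2 * pi * a * t)"
          by (simp add: E_def norm_exp_eq_Re power2_eq_square t_def algebra_simps diff_divide_distrib)
        moreover have "pi / 2 * ((Re z)\<^sup>2 - (Im z)\<^sup>2) - 2 * pi * a * t + - pi / 2 * (cmod z)\<^sup>2
            = - (pi * (Im k)\<^sup>2) + - pi * t\<^sup>2 - 2 * pi * ((a + Im k) * t)"
          unfolding cmod_power2 t_def by (simp add: power2_eq_square algebra_simps add_divide_distrib diff_divide_distrib)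
        ultimately have "cmod (E z) * exp (- pi / 2 * (cmod z)\<^sup>2) = exp (- (pi * (Im k)\<^sup>2) + - pi * t\<^sup>2 - 2 * pi * ((a + Im k) * t))"
          by (simp only: exp_add[symmetric])
        also have "- ((a + Im k) * t) \<le> \<bar>t\<bar>"
        proof -
          have "\<bar>(a + Im k) * t\<bar> \<le> 1 * \<bar>t\<bar>" unfolding abs_mult using a by (intro mult_right_mono) auto
          thus ?thesis by linarith
        qed
        hence "2 * pi * (- ((a + Im k) * t)) \<le> 2 * pi * \<bar>t\<bar>" by (intro mult_left_mono) auto
        hence "exp (- (pi * (Im k)\<^sup>2) + - pi * t\<^sup>2 - 2 * pi * ((a + Im k) * t)) \<le> exp (- (pi * (Im k)\<^sup>2) + (- pi * t\<^sup>2 + 2 * pi * \<bar>t\<bar>))"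
          by simp
        finally show ?thesis by (simp only: exp_add)
      qed
      have 2: "cmod (\<phi> z) \<le> exp (ln 2 + 2 * pi * \<bar>t\<bar>)"
      proof -
        have "cmod (\<phi> z) \<le> 1 + cmod (exp (2 * of_real pi * \<i> * (z - k)))"
          unfolding \<phi>_def using norm_triangle_ineq4[of 1] by (metis norm_one)
        also have "cmod (exp (2 * of_real pi * \<i> * (z - k))) = exp (2 * pi * (- t))"
          by (simp add: norm_exp_eq_Re t_def algebra_simps)
        also have "2 * pi * (- t) \<le> 2 * pi * \<bar>t\<bar>" by (intro mult_left_mono) auto
        hence "exp (2 * pi * (- t)) \<le> exp (2 * pi * \<bar>t\<bar>)" by simp
        also have "1 + exp (2 * pi * \<bar>t\<bar>) \<le> 2 * exp (2 * pi * \<bar>t\<bar>)" by simp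
        finally show ?thesis by (simp add: exp_add)
      qed
      have "cmod (B z) * exp (- pi / 2 * (cmod z)\<^sup>2) =
          inverse (cmod v) * ((cmod (E z) * exp (- pi / 2 * (cmod z)\<^sup>2)) * cmod (\<phi> z) ^ r * cmod (P z) ^ Suc r)"
        by (simp add: B_def norm_mult norm_inverse norm_power)
      also have "\<dots> \<le> (D * exp (- pi / 2 * (cmod k)\<^sup>2) * exp (pi * (Im k)\<^sup>2)) *
          ((exp (- (pi * (Im k)\<^sup>2)) * exp (- pi * t\<^sup>2 + 2 * pi * \<bar>t\<bar>)) *
            exp (ln 2 + 2 * pi * \<bar>t\<bar>) ^ r * exp (growth \<bar>t\<bar> + growth 0) ^ Suc r)"
        using D P(5)[of z] by (intro mult_mono inv_v 1 2 power_mono) (auto simp: t_def)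
      also have "\<dots> = D * exp (- pi / 2 * (cmod k)\<^sup>2) * (exp (pi * (Im k)\<^sup>2) * exp (- (pi * (Im k)\<^sup>2))) *
          (exp (- pi * t\<^sup>2 + 2 * pi * \<bar>t\<bar>) * exp (real r * (ln 2 + 2 * pi * \<bar>t\<bar>)) * exp (real (Suc r) * (growth \<bar>t\<bar> + growth 0)))"
        by (simp only: exp_of_nat_mult mult_ac)
      also have "exp (pi * (Im k)\<^sup>2) * exp (- (pi * (Im k)\<^sup>2)) = 1" by (simp flip: exp_add)
      also have "exp (- pi * t\<^sup>2 + 2 * pi * \<bar>t\<bar>) * exp (real r * (ln 2 + 2 * pi * \<bar>t\<bar>)) * exp (real (Suc r) * (growth \<bar>t\<bar> + growth 0))
         = exp (- pi * t\<^sup>2 + 2 * pi * \<bar>t\<bar> + r * (ln 2 + 2 * pi * \<bar>t\<bar>) + (real r + 1) * (growth \<bar>t\<bar> + growth 0))"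
        by (simp only: exp_add of_nat_Suc add.commute[of 1])
      also have "D * exp (- pi / 2 * (cmod k)\<^sup>2) * 1 * \<dots> \<le> D * exp (- pi / 2 * (cmod k)\<^sup>2) * 1 * exp (L - \<bar>t\<bar>)"
        using D exponent[of t] by (intro mult_left_mono) auto
      also have "\<dots> = D * exp L * exp (- pi / 2 * (cmod k)\<^sup>2) * exp (- \<bar>Im k - Im z\<bar>)"
        by (simp add: t_def exp_diff exp_minus field_simps abs_minus_commute)
      finally show ?thesis .
    qed
    ultimately show "\<exists>B. fundamental_function \<nu> r (D * exp L) k B"
      unfolding fundamental_function_def by blast
  qed
qed

end

section \<open>Superpositions in the Fock norm\<close>

text \<open>Lets a sum over the points be exchanged with an integral by Tonelli's theorem.\<close>

lemma ennreal_infsum_eq_nn_integral: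
  fixes f :: "'a \<Rightarrow> real"
  assumes "\<And>x. x \<in> A \<Longrightarrow> 0 \<le> f x" "f summable_on A"
  shows "ennreal (infsum f A) = (\<integral>\<^sup>+x. ennreal (f x) \<partial>count_space A)"
proof -
  have abs: "Infinite_Sum.abs_summable_on f A"
    using assms(2) summable_on_iff_abs_summable_on_real by blast
  hence "integrable (count_space A) f"
    unfolding abs_summable_equivalent Infinite_Set_Sum.abs_summable_on_def .
  moreover have "infsum f A = integral\<^sup>L (count_space A) f"
    using infsetsum_infsum[of f A] abs unfolding abs_summable_equivalent infsetsum_def by simp
  ultimately show ?thesis
    using nn_integral_eq_integral[of "count_space A" f] assms(1) by (simp add: AE_count_space)
qed

text \<open>The strip is covered by unit squares stacked upwards and downwards from the height \<open>y\<close>; on the \<open>m\<close>-th ones the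
  integrand is at most \<open>exp (- m)\<close>.\<close>

lemma nn_integral_strip_exp_le:
  "(\<integral>\<^sup>+z. indicator strip z * ennreal (exp (- \<bar>y - Im z\<bar>)) \<partial>lborel)
     \<le> ennreal (2 * (\<Sum>m. exp (- real m)))"
proof -
  define U where "U m = cbox (Complex 0 (y + real m)) (Complex 1 (y + real m + 1))" for m
  define L where "L m = cbox (Complex 0 (y - real m - 1)) (Complex 1 (y - real m))" for m
  have em: "emeasure lborel (U m) = 1" "emeasure lborel (L m) = 1" for m
    by (simp_all add: U_def L_def emeasure_lborel_cbox_eq Basis_complex_def inner_complex_def)
  have summable: "summable (\<lambda>m. exp (- real m))"
    using summable_geometric[of "exp (-1 :: real)"] by (simp add: exp_of_nat_mult[symmetric])
  define h :: "nat \<Rightarrow> complex \<Rightarrow> ennreal" where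
    "h m z = ennreal (exp (- real m)) * (indicator (U m) z + indicator (L m) z)" for m z
  have pw: "indicator strip z * ennreal (exp (- \<bar>y - Im z\<bar>)) \<le> (\<Sum>m. h m z)" for z
  proof (cases "z \<in> strip")
    case True
    define m where "m = nat \<lfloor>\<bar>y - Im z\<bar>\<rfloor>"
    have m: "real m \<le> \<bar>y - Im z\<bar>" "\<bar>y - Im z\<bar> \<le> real m + 1" unfolding m_def by linarith+
    have "z \<in> U m \<or> z \<in> L m"
      using True m by (auto simp: strip_def U_def L_def in_cbox_complex_iff)
    hence "1 \<le> (indicator (U m) z + indicator (L m) z :: ennreal)"
      by (auto simp: indicator_def)
    moreover have "ennreal (exp (- \<bar>y - Im z\<bar>)) \<le> ennreal (exp (- real m))"
      using m by (intro ennreal_leI) auto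
    ultimately have "ennreal (exp (- \<bar>y - Im z\<bar>)) * 1 \<le> h m z"
      unfolding h_def by (intro mult_mono) auto
    also have "h m z \<le> (\<Sum>m. h m z)"
      using sum_le_suminf[of "\<lambda>m. h m z" "{m}"] by (simp add: summableI)
    finally show ?thesis using True by simp
  qed auto
  have "(\<integral>\<^sup>+z. indicator strip z * ennreal (exp (- \<bar>y - Im z\<bar>)) \<partial>lborel) \<le> (\<integral>\<^sup>+z. (\<Sum>m. h m z) \<partial>lborel)"
    by (intro nn_integral_mono pw)
  also have "\<dots> = (\<Sum>m. \<integral>\<^sup>+z. h m z \<partial>lborel)"
    by (intro nn_integral_suminf) (auto simp: h_def[abs_def] U_def L_def)
  also have "(\<lambda>m. \<integral>\<^sup>+z. h m z \<partial>lborel) = (\<lambda>m. ennreal (2 * exp (- real m)))"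
  proof
    fix m
    have [measurable]: "U m \<in> sets lborel" "L m \<in> sets lborel" by (auto simp: U_def L_def)
    have "(\<integral>\<^sup>+z. indicator (U m) z + indicator (L m) z \<partial>lborel) = 1 + (1 :: ennreal)"
    proof -
      have "(\<integral>\<^sup>+z. indicator (U m) z \<partial>lborel) = 1" "(\<integral>\<^sup>+z. indicator (L m) z \<partial>lborel) = 1"
        using em[of m] by (subst nn_integral_indicator; simp add: U_def L_def)+
      moreover have "indicator (U m) \<in> borel_measurable lborel" "indicator (L m) \<in> borel_measurable lborel"
        by measurable
      ultimately show ?thesis
        using nn_integral_add[of "indicator (U m)" lborel "indicator (L m)"] by simp
    qed
    moreover
    have "(\<integral>\<^sup>+z. h m z \<partial>lborel) = ennreal (exp (- real m)) *
        (\<integral>\<^sup>+z. indicator (U m) z + indicator (L m) z \<partial>lborel)"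
      unfolding h_def by (rule nn_integral_cmult) measurable
    ultimately show "(\<integral>\<^sup>+z. h m z \<partial>lborel) = ennreal (2 * exp (- real m))"
      by (simp add: ennreal_mult mult.commute)
  qed
  also have "(\<Sum>m. ennreal (2 * exp (- real m))) = ennreal (\<Sum>m. 2 * exp (- real m))"
    using summable by (intro suminf_ennreal2 summable_mult) auto
  also have "(\<Sum>m. 2 * exp (- real m)) = 2 * (\<Sum>m. exp (- real m))"
    using summable by (rule suminf_mult)
  finally show ?thesis .
qed

context sparse_points
begin

text \<open>The profile, in the imaginary direction, of a superposition of functions that decay exponentially
  away from the heights of the points.\<close>

definition envelope :: "(complex \<Rightarrow> real) \<Rightarrow> real \<Rightarrow> real" where
  "envelope b y = (\<Sum>\<^sub>\<infinity>j\<in>Z. b j * exp (- \<bar>Im j - y\<bar>))"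

text \<open>A majorant of the terms that does not depend on \<open>y\<close>, as long as \<open>y\<close> stays bounded: it comes from
  \<open>b e \<le> b\<^sup>2 + e\<^sup>2\<close> and \<open>e \<le> 1\<close> for the exponential \<open>e\<close>.\<close>

lemma envelope_majorant:
  assumes "(\<lambda>j. (b j)\<^sup>2) summable_on Z"
  shows "(\<lambda>j. (b j)\<^sup>2 + exp R * exp (- \<bar>Im j\<bar>)) summable_on Z"
    and "\<bar>y\<bar> \<le> R \<Longrightarrow> b j * exp (- \<bar>Im j - y\<bar>) \<le> (b j)\<^sup>2 + exp R * exp (- \<bar>Im j\<bar>)"
proof -
  show "(\<lambda>j. (b j)\<^sup>2 + exp R * exp (- \<bar>Im j\<bar>)) summable_on Z"
    using summable_exp_dist[of 1 0] assms by (intro summable_on_add summable_on_cmult_right) auto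
  assume y: "\<bar>y\<bar> \<le> R"
  let ?e = "exp (- \<bar>Im j - y\<bar>)"
  have "0 \<le> (b j - ?e / 2)\<^sup>2" by simp
  hence "b j * ?e \<le> (b j)\<^sup>2 + ?e * ?e"
  proof -
    have "0 \<le> ?e * ?e" by simp
    moreover have "(b j - ?e / 2)\<^sup>2 = (b j)\<^sup>2 - b j * ?e + ?e * ?e / 4" by (simp add: power2_eq_square algebra_simps)
    ultimately show ?thesis using \<open>0 \<le> (b j - ?e / 2)\<^sup>2\<close> by linarith
  qed
  also have "?e * ?e \<le> ?e * 1" by (intro mult_left_mono) auto
  also have "?e \<le> exp R * exp (- \<bar>Im j\<bar>)" using y by (simp flip: exp_add)
  finally show "b j * ?e \<le> (b j)\<^sup>2 + exp R * exp (- \<bar>Im j\<bar>)" by simp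
qed

lemma summable_envelope:
  assumes "(\<lambda>j. (b j)\<^sup>2) summable_on Z" "\<And>j. j \<in> Z \<Longrightarrow> 0 \<le> b j"
  shows "(\<lambda>j. b j * exp (- \<bar>Im j - y\<bar>)) summable_on Z"
  by (rule summable_on_comparison_test[OF envelope_majorant(1)[OF assms(1), of "\<bar>y\<bar>"]])
     (use assms in \<open>auto intro: envelope_majorant(2)\<close>)

text \<open>Lets Cauchy's estimate move from a point to the unit circle about it at the cost of a constant factor.\<close>

lemma envelope_mono_shift:
  assumes "(\<lambda>j. (b j)\<^sup>2) summable_on Z" "\<And>j. j \<in> Z \<Longrightarrow> 0 \<le> b j" "\<bar>x - y\<bar> \<le> 1"
  shows "envelope b x \<le> exp 1 * envelope b y"
proof -
  have "envelope b x \<le> (\<Sum>\<^sub>\<infinity>j\<in>Z. exp 1 * (b j * exp (- \<bar>Im j - y\<bar>)))"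
    unfolding envelope_def
  proof (intro infsum_mono summable_envelope summable_on_cmult_right assms)
    fix j assume "j \<in> Z"
    have "b j * exp (- \<bar>Im j - x\<bar>) \<le> b j * exp (1 - \<bar>Im j - y\<bar>)"
      using assms(2)[OF \<open>j \<in> Z\<close>] assms(3) by (intro mult_left_mono) auto
    thus "b j * exp (- \<bar>Im j - x\<bar>) \<le> exp 1 * (b j * exp (- \<bar>Im j - y\<bar>))"
      by (simp add: exp_diff exp_minus field_simps)
  qed auto
  also have "\<dots> = exp 1 * envelope b y" unfolding envelope_def by (rule infsum_cmult_right')
  finally show ?thesis .
qed

lemma envelope_nonneg: "(\<And>j. j \<in> Z \<Longrightarrow> 0 \<le> b j) \<Longrightarrow> 0 \<le> envelope b y"
  unfolding envelope_def by (intro infsum_nonneg) auto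

text \<open>Cauchy-Schwarz with the exponential split evenly between the two factors.\<close>

lemma envelope_square_le:
  assumes b: "(\<lambda>j. (b j)\<^sup>2) summable_on Z" "\<And>j. j \<in> Z \<Longrightarrow> 0 \<le> b j"
  shows "(\<lambda>j. (b j)\<^sup>2 * exp (- \<bar>Im j - y\<bar>)) summable_on Z"
    and "(envelope b y)\<^sup>2 \<le> expsum 1 * (\<Sum>\<^sub>\<infinity>j\<in>Z. (b j)\<^sup>2 * exp (- \<bar>Im j - y\<bar>))"
proof -
  let ?T = "\<Sum>\<^sub>\<infinity>j\<in>Z. (b j)\<^sup>2 * exp (- \<bar>Im j - y\<bar>)"
  show T: "(\<lambda>j. (b j)\<^sup>2 * exp (- \<bar>Im j - y\<bar>)) summable_on Z"
    by (rule summable_on_comparison_test[OF b(1)]) (auto intro: mult_left_le)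
  have "envelope b y \<le> sqrt (expsum 1 * ?T)"
    unfolding envelope_def
  proof (rule infsum_le_finite_sums[OF summable_envelope[OF b]])
    fix A assume A: "finite A" "A \<subseteq> Z"
    have sq: "exp (- \<bar>Im j - y\<bar> / 2) * exp (- \<bar>Im j - y\<bar> / 2) = exp (- \<bar>Im j - y\<bar>)" for j
      by (simp flip: exp_add)
    have "(\<Sum>j\<in>A. (b j * exp (- \<bar>Im j - y\<bar> / 2)) * exp (- \<bar>Im j - y\<bar> / 2))\<^sup>2 \<le>
       (\<Sum>j\<in>A. (b j * exp (- \<bar>Im j - y\<bar> / 2))\<^sup>2) * (\<Sum>j\<in>A. (exp (- \<bar>Im j - y\<bar> / 2))\<^sup>2)"
      by (rule Cauchy_Schwarz_ineq_sum)
    hence "(\<Sum>j\<in>A. b j * exp (- \<bar>Im j - y\<bar>))\<^sup>2 \<le> (\<Sum>j\<in>A. (b j)\<^sup>2 * exp (- \<bar>Im j - y\<bar>)) * (\<Sum>j\<in>A. exp (- \<bar>Im j - y\<bar>))"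
      by (simp only: power_mult_distrib mult.assoc sq) (simp only: power2_eq_square mult.assoc sq)
    also have "\<dots> \<le> ?T * expsum 1"
      using sum_exp_dist_le[OF A, of 1 y]
      by (intro mult_mono finite_sum_le_infsum T A sum_nonneg infsum_nonneg) auto
    finally show "(\<Sum>j\<in>A. b j * exp (- \<bar>Im j - y\<bar>)) \<le> sqrt (expsum 1 * ?T)"
      by (intro real_le_rsqrt) (simp add: mult.commute)
  qed
  hence "(envelope b y)\<^sup>2 \<le> (sqrt (expsum 1 * ?T))\<^sup>2"
    using envelope_nonneg[OF b(2)] by (intro power_mono) auto
  also have "\<dots> = expsum 1 * ?T"
    using expsum_nonneg[of 1] by (intro real_sqrt_pow2 mult_nonneg_nonneg infsum_nonneg) auto
  finally show "(envelope b y)\<^sup>2 \<le> expsum 1 * ?T" .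
qed

lemma fock_norm_le_of_envelope:
  assumes b: "(\<lambda>j. (b j)\<^sup>2) summable_on Z" "\<And>j. j \<in> Z \<Longrightarrow> 0 \<le> b j"
    and F: "continuous_on UNIV F" and "K \<ge> 0"
    and bound: "\<And>w. cmod (F w) * exp (- pi / 2 * (cmod w)\<^sup>2) \<le> K * envelope b (Im w)"
  shows "fock_square_integrable F"
    and "fock_norm F \<le> K * sqrt (expsum 1 * (2 * (\<Sum>m. exp (- real m)))) * sqrt (\<Sum>\<^sub>\<infinity>j\<in>Z. (b j)\<^sup>2)"
proof -
  define G where "G = 2 * (\<Sum>m. exp (- real m))"
  have summable: "summable (\<lambda>m. exp (- real m))"
    using summable_geometric[of "exp (-1 :: real)"] by (simp add: exp_of_nat_mult[symmetric])
  have G: "G \<ge> 0" unfolding G_def using summable by (auto intro!: suminf_nonneg)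
  define g where "g z = (cmod (F z))\<^sup>2 * exp (- pi * (cmod z)\<^sup>2)" for z
  have strip: "strip \<in> sets borel"
  proof -
    have "strip = Re -` {0..<1} \<inter> space borel" by (auto simp: strip_def)
    thus ?thesis by (metis borel_measurable_Re atLeastLessThan_borel measurable_sets)
  qed
  note strip [measurable]
  have [measurable]: "(\<lambda>z. ennreal (exp (- \<bar>y - Im z\<bar>))) \<in> borel_measurable borel" for y
    by (intro measurable_compose[OF _ measurable_ennreal] borel_measurable_continuous_onI continuous_intros)
  have gm: "g \<in> borel_measurable borel"
    unfolding g_def[abs_def] by (intro borel_measurable_continuous_onI continuous_intros F)
  have meas: "(\<lambda>z. indicator strip z *\<^sub>R g z) \<in> borel_measurable lborel"
    using strip gm by (intro borel_measurable_scaleR borel_measurable_indicator) auto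
  have g_le: "g z \<le> K\<^sup>2 * expsum 1 * (\<Sum>\<^sub>\<infinity>j\<in>Z. (b j)\<^sup>2 * exp (- \<bar>Im j - Im z\<bar>))" for z
  proof -
    have "g z = (cmod (F z) * exp (- pi / 2 * (cmod z)\<^sup>2))\<^sup>2"
      by (simp add: g_def power_mult_distrib flip: exp_double)
    also have "\<dots> \<le> (K * envelope b (Im z))\<^sup>2" using bound by (intro power_mono) auto
    also have "\<dots> \<le> K\<^sup>2 * (expsum 1 * (\<Sum>\<^sub>\<infinity>j\<in>Z. (b j)\<^sup>2 * exp (- \<bar>Im j - Im z\<bar>)))"
      unfolding power_mult_distrib by (intro mult_left_mono envelope_square_le b) auto
    finally show ?thesis by (simp add: mult.assoc)
  qed
  have KE: "0 \<le> K\<^sup>2 * expsum 1" using expsum_nonneg[of 1] by simp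
  have "(\<integral>\<^sup>+z. ennreal (indicator strip z *\<^sub>R g z) \<partial>lborel) \<le>
      (\<integral>\<^sup>+z. \<integral>\<^sup>+j. ennreal (K\<^sup>2 * expsum 1 * (b j)\<^sup>2) * (indicator strip z * ennreal (exp (- \<bar>Im j - Im z\<bar>))) \<partial>count_space Z \<partial>lborel)"
  proof (rule nn_integral_mono)
    fix z
    have "ennreal (g z) \<le> ennreal (K\<^sup>2 * expsum 1 * (\<Sum>\<^sub>\<infinity>j\<in>Z. (b j)\<^sup>2 * exp (- \<bar>Im j - Im z\<bar>)))"
      by (intro ennreal_leI g_le)
    also have "\<dots> = ennreal (\<Sum>\<^sub>\<infinity>j\<in>Z. K\<^sup>2 * expsum 1 * ((b j)\<^sup>2 * exp (- \<bar>Im j - Im z\<bar>)))"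
      by (simp only: infsum_cmult_right')
    also have "\<dots> = (\<integral>\<^sup>+j. ennreal (K\<^sup>2 * expsum 1 * ((b j)\<^sup>2 * exp (- \<bar>Im j - Im z\<bar>))) \<partial>count_space Z)"
      using KE by (intro ennreal_infsum_eq_nn_integral summable_on_cmult_right envelope_square_le b) auto
    also have "\<dots> = (\<integral>\<^sup>+j. ennreal (K\<^sup>2 * expsum 1 * (b j)\<^sup>2) * ennreal (exp (- \<bar>Im j - Im z\<bar>)) \<partial>count_space Z)"
    proof (rule nn_integral_cong)
      fix j
      have "0 \<le> K\<^sup>2 * expsum 1 * (b j)\<^sup>2" using expsum_nonneg[of 1] by simp
      thus "ennreal (K\<^sup>2 * expsum 1 * ((b j)\<^sup>2 * exp (- \<bar>Im j - Im z\<bar>))) =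
        ennreal (K\<^sup>2 * expsum 1 * (b j)\<^sup>2) * ennreal (exp (- \<bar>Im j - Im z\<bar>))"
        by (subst ennreal_mult[symmetric]) (simp_all add: mult.assoc)
    qed
    finally show "ennreal (indicator strip z *\<^sub>R g z) \<le>
      (\<integral>\<^sup>+j. ennreal (K\<^sup>2 * expsum 1 * (b j)\<^sup>2) * (indicator strip z * ennreal (exp (- \<bar>Im j - Im z\<bar>))) \<partial>count_space Z)"
      by (cases "z \<in> strip") auto
  qed
  also have "\<dots> = (\<integral>\<^sup>+j. \<integral>\<^sup>+z. ennreal (K\<^sup>2 * expsum 1 * (b j)\<^sup>2) * (indicator strip z * ennreal (exp (- \<bar>Im j - Im z\<bar>))) \<partial>lborel \<partial>count_space Z)"
    using countable_Z by (intro nn_integral_count_space_nn_integral) measurable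
  also have "\<dots> \<le> (\<integral>\<^sup>+j. ennreal (K\<^sup>2 * expsum 1 * (b j)\<^sup>2) * ennreal G \<partial>count_space Z)"
  proof (rule nn_integral_mono)
    fix j
    have "(\<integral>\<^sup>+z. ennreal (K\<^sup>2 * expsum 1 * (b j)\<^sup>2) * (indicator strip z * ennreal (exp (- \<bar>Im j - Im z\<bar>))) \<partial>lborel)
      = ennreal (K\<^sup>2 * expsum 1 * (b j)\<^sup>2) * (\<integral>\<^sup>+z. (indicator strip z * ennreal (exp (- \<bar>Im j - Im z\<bar>))) \<partial>lborel)"
      by (intro nn_integral_cmult) measurable
    also have "\<dots> \<le> ennreal (K\<^sup>2 * expsum 1 * (b j)\<^sup>2) * ennreal G"
      unfolding G_def by (intro mult_left_mono nn_integral_strip_exp_le) auto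
    finally show "(\<integral>\<^sup>+z. ennreal (K\<^sup>2 * expsum 1 * (b j)\<^sup>2) * (indicator strip z * ennreal (exp (- \<bar>Im j - Im z\<bar>))) \<partial>lborel) \<le> \<dots>" .
  qed
  also have "\<dots> = (\<integral>\<^sup>+j. ennreal (K\<^sup>2 * expsum 1 * G * (b j)\<^sup>2) \<partial>count_space Z)"
  proof (rule nn_integral_cong)
    fix j
    have "0 \<le> K\<^sup>2 * expsum 1 * (b j)\<^sup>2" using expsum_nonneg[of 1] by simp
    thus "ennreal (K\<^sup>2 * expsum 1 * (b j)\<^sup>2) * ennreal G = ennreal (K\<^sup>2 * expsum 1 * G * (b j)\<^sup>2)"
      using G by (subst ennreal_mult[symmetric]) (simp_all add: mult_ac)
  qed
  also have "\<dots> = ennreal (\<Sum>\<^sub>\<infinity>j\<in>Z. K\<^sup>2 * expsum 1 * G * (b j)\<^sup>2)"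
    using expsum_nonneg[of 1] G by (intro ennreal_infsum_eq_nn_integral[symmetric] summable_on_cmult_right b) auto
  also have "(\<Sum>\<^sub>\<infinity>j\<in>Z. K\<^sup>2 * expsum 1 * G * (b j)\<^sup>2) = K\<^sup>2 * expsum 1 * G * (\<Sum>\<^sub>\<infinity>j\<in>Z. (b j)\<^sup>2)"
    by (rule infsum_cmult_right')
  finally have nn: "(\<integral>\<^sup>+z. ennreal (indicator strip z *\<^sub>R g z) \<partial>lborel) \<le> ennreal (K\<^sup>2 * expsum 1 * G * (\<Sum>\<^sub>\<infinity>j\<in>Z. (b j)\<^sup>2))" .
  have nonneg: "0 \<le> indicator strip z *\<^sub>R g z" for z by (simp add: g_def)
  have int: "integrable lborel (\<lambda>z. indicator strip z *\<^sub>R g z)"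
    using meas nonneg nn by (intro integrableI_nonneg) (auto simp: le_less_trans)
  thus "fock_square_integrable F"
    unfolding fock_square_integrable_def set_integrable_def g_def .
  have "ennreal (LINT z|lborel. indicator strip z *\<^sub>R g z) = (\<integral>\<^sup>+z. ennreal (indicator strip z *\<^sub>R g z) \<partial>lborel)"
    using int nonneg by (intro nn_integral_eq_integral[symmetric]) auto
  hence "ennreal (LINT z|lborel. indicator strip z *\<^sub>R g z) \<le> ennreal (K\<^sup>2 * expsum 1 * G * (\<Sum>\<^sub>\<infinity>j\<in>Z. (b j)\<^sup>2))"
    using nn by simp
  moreover have "0 \<le> K\<^sup>2 * expsum 1 * G * (\<Sum>\<^sub>\<infinity>j\<in>Z. (b j)\<^sup>2)"
    using expsum_nonneg[of 1] G by (intro mult_nonneg_nonneg infsum_nonneg) auto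
  ultimately have "(LINT z|lborel. indicator strip z *\<^sub>R g z) \<le> K\<^sup>2 * expsum 1 * G * (\<Sum>\<^sub>\<infinity>j\<in>Z. (b j)\<^sup>2)"
    by (simp add: ennreal_le_iff)
  hence "fock_norm F \<le> sqrt (K\<^sup>2 * (expsum 1 * G) * (\<Sum>\<^sub>\<infinity>j\<in>Z. (b j)\<^sup>2))"
    unfolding fock_norm_def set_lebesgue_integral_def g_def by (simp add: mult.assoc)
  thus "fock_norm F \<le> K * sqrt (expsum 1 * (2 * (\<Sum>m. exp (- real m)))) * sqrt (\<Sum>\<^sub>\<infinity>j\<in>Z. (b j)\<^sup>2)"
    using \<open>K \<ge> 0\<close> by (simp only: real_sqrt_mult G_def real_sqrt_abs abs_of_nonneg)
qed

end

section \<open>The interpolation theorem\<close>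

lemma true_poly_sum:
  assumes "finite A" "\<And>k. k \<in> A \<Longrightarrow> B k holomorphic_on UNIV"
  shows "true_poly r (\<lambda>z. \<Sum>k\<in>A. a k * B k z) w = (\<Sum>k\<in>A. a k * true_poly r (B k) w)"
proof -
  let ?L = "\<lambda>F. (deriv ^^ r) (\<lambda>u. exp (- of_real pi * u * cnj w) * F u) w"
  have "?L (\<lambda>z. \<Sum>k\<in>A. a k * B k z) = (\<Sum>k\<in>A. a k * ?L (B k))"
    using assms
  proof (induction A rule: finite_induct)
    case (insert x A)
    have hol: "B x holomorphic_on UNIV" "(\<lambda>z. \<Sum>k\<in>A. a k * B k z) holomorphic_on UNIV"
      using insert.prems by (auto intro!: holomorphic_intros)
    have "?L (\<lambda>z. \<Sum>k\<in>insert x A. a k * B k z) =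
        (deriv ^^ r) (\<lambda>u. a x * (exp (- of_real pi * u * cnj w) * B x u) +
           exp (- of_real pi * u * cnj w) * (\<Sum>k\<in>A. a k * B k u)) w"
      using insert.hyps by (simp add: algebra_simps)
    also have "\<dots> = (deriv ^^ r) (\<lambda>u. a x * (exp (- of_real pi * u * cnj w) * B x u)) w + ?L (\<lambda>z. \<Sum>k\<in>A. a k * B k z)"
      by (rule higher_deriv_add[of _ UNIV]) (use hol in \<open>auto intro!: holomorphic_intros\<close>)
    also have "(deriv ^^ r) (\<lambda>u. a x * (exp (- of_real pi * u * cnj w) * B x u)) w = a x * ?L (B x)"
      by (rule higher_deriv_cmult[of _ UNIV]) (use hol in \<open>auto intro!: holomorphic_intros\<close>)
    finally show ?case using insert by simp
  qed simp
  moreover have "(\<lambda>z. \<Sum>k\<in>A. a k * B k z) holomorphic_on UNIV"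
    using assms by (intro holomorphic_intros) auto
  ultimately show ?thesis
    using assms(2) by (simp add: true_poly_eq sum_distrib_left mult_ac cong: sum.cong)
qed

text \<open>Locally uniform convergence of entire functions carries over to their derivatives, and a value of
  \<^const>\<open>true_poly\<close> is a finite combination of these.\<close>

lemma tendsto_true_poly:
  assumes lim: "\<And>R. uniform_limit (cball 0 R) f F G" and "G \<noteq> bot"
    and hol: "\<And>n. eventually (\<lambda>n. f n holomorphic_on UNIV) G"
  shows "F holomorphic_on UNIV" and "((\<lambda>n. true_poly r (f n) w) \<longlongrightarrow> true_poly r F w) G"
proof -
  have "F holomorphic_on ball 0 R" for R
  proof -
    have "eventually (\<lambda>n. continuous_on (cball 0 R) (f n) \<and> f n holomorphic_on ball 0 R) G"
      using hol by eventually_elim (meson holomorphic_on_imp_continuous_on holomorphic_on_subset subset_UNIV)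
    from holomorphic_uniform_limit[OF this lim assms(2)] show ?thesis by blast
  qed
  hence "F field_differentiable (at z)" for z
    using holomorphic_on_imp_differentiable_at[of F "ball 0 (cmod z + 1)" z] by simp
  thus F: "F holomorphic_on UNIV"
    by (simp add: holomorphic_on_def)
  have d: "((\<lambda>n. (deriv ^^ i) (f n) w) \<longlongrightarrow> (deriv ^^ i) F w) G" for i
  proof (rule higher_deriv_complex_uniform_limit[where A = "ball 0 (cmod w + 1)"])
    show "uniform_limit (ball 0 (cmod w + 1)) f F G"
      by (rule uniform_limit_on_subset[OF lim ball_subset_cball])
    show "eventually (\<lambda>n. f n holomorphic_on ball 0 (cmod w + 1)) G"
      using hol by eventually_elim (meson holomorphic_on_subset subset_UNIV)
  qed (use assms(2) in auto)
  let ?T = "\<lambda>H. of_real (sqrt (pi ^ r / fact r)) * of_real (exp (pi * (cmod w)\<^sup>2)) *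
     (\<Sum>i\<le>r. (of_nat (r choose i) * (- of_real pi) ^ i) * cnj w ^ i * exp (- of_real pi * w * cnj w) * (deriv ^^ (r - i)) H w)"
  have T: "true_poly r H w = ?T H" if "H holomorphic_on UNIV" for H
    using true_poly_eq[OF that] higher_deriv_exp_mult[OF that] by simp
  have "((\<lambda>n. ?T (f n)) \<longlongrightarrow> ?T F) G" by (intro tendsto_intros d)
  moreover have "eventually (\<lambda>n. ?T (f n) = true_poly r (f n) w) G"
    using hol by eventually_elim (simp add: T)
  ultimately show "((\<lambda>n. true_poly r (f n) w) \<longlongrightarrow> true_poly r F w) G"
    unfolding T[OF F] by (rule Lim_transform_eventually)
qed

context sparse_points
begin

lemma interpolating_of_sparse:
  assumes sparse: "(real r + 1) * N < \<rho>"
  shows "interpolating \<nu> r Z"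
proof -
  obtain C where C: "C > 0" "\<forall>k\<in>Z. \<exists>B. fundamental_function \<nu> r C k B"
    using ex_fundamental_function[OF sparse] by blast
  obtain B where "\<forall>k\<in>Z. fundamental_function \<nu> r C k (B k)"
    using bchoice[OF C(2)] by blast
  hence B: "\<And>k. k \<in> Z \<Longrightarrow> B k holomorphic_on UNIV" "\<And>k. k \<in> Z \<Longrightarrow> quasi_periodic \<nu> (B k)"
    "\<And>k j. k \<in> Z \<Longrightarrow> j \<in> Z \<Longrightarrow> true_poly r (B k) j = (if j = k then 1 else 0)"
    "\<And>k z. k \<in> Z \<Longrightarrow> cmod (B k z) * exp (- pi / 2 * (cmod z)\<^sup>2) \<le> C * exp (- pi / 2 * (cmod k)\<^sup>2) * exp (- \<bar>Im k - Im z\<bar>)"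
    by (simp_all add: fundamental_function_def)
  define K where "K = sqrt (pi ^ r / fact r) * fact r * exp (pi / 2) * (C * exp 1)"
  have K: "K \<ge> 0" using C(1) by (simp add: K_def)
  show ?thesis unfolding interpolating_def
  proof (intro exI[of _ "K * sqrt (expsum 1 * (2 * (\<Sum>m. exp (- real m))))"] allI impI)
    fix a :: "complex \<Rightarrow> complex"
    assume a: "(\<lambda>z. (cmod (a z))\<^sup>2 * exp (- pi * (cmod z)\<^sup>2)) summable_on Z"
    define b where "b k = cmod (a k) * exp (- pi / 2 * (cmod k)\<^sup>2)" for k
    have b2: "(\<lambda>k. (b k)\<^sup>2) = (\<lambda>z. (cmod (a z))\<^sup>2 * exp (- pi * (cmod z)\<^sup>2))"
      by (simp add: b_def power_mult_distrib flip: exp_double)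
    have b: "(\<lambda>k. (b k)\<^sup>2) summable_on Z" "\<And>k. k \<in> Z \<Longrightarrow> 0 \<le> b k"
      using a by (simp_all add: b2) (simp add: b_def)
    define F\<^sub>0 where "F\<^sub>0 z = (\<Sum>\<^sub>\<infinity>k\<in>Z. a k * B k z)" for z
    have term_le: "cmod (a k * B k z) \<le> C * exp (pi / 2 * (cmod z)\<^sup>2) * (b k * exp (- \<bar>Im k - Im z\<bar>))" if "k \<in> Z" for k z
    proof -
      have "exp (- pi / 2 * (cmod z)\<^sup>2) * exp (pi / 2 * (cmod z)\<^sup>2) = 1" by (simp flip: exp_add)
      hence "cmod (a k * B k z) = (cmod (a k) * exp (pi / 2 * (cmod z)\<^sup>2)) * (cmod (B k z) * exp (- pi / 2 * (cmod z)\<^sup>2))"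
        by (simp add: norm_mult mult_ac)
      also have "\<dots> \<le> (cmod (a k) * exp (pi / 2 * (cmod z)\<^sup>2)) * (C * exp (- pi / 2 * (cmod k)\<^sup>2) * exp (- \<bar>Im k - Im z\<bar>))"
        using B(4)[OF that] by (intro mult_left_mono) auto
      finally show ?thesis by (simp only: b_def mult_ac)
    qed
    have lim: "uniform_limit (cball 0 R) (\<lambda>A z. \<Sum>k\<in>A. a k * B k z) F\<^sub>0 (finite_subsets_at_top Z)" for R
      unfolding F\<^sub>0_def
    proof (rule Weierstrass_m_test_general)
      show "(\<lambda>k. C * exp (pi / 2 * R\<^sup>2) * ((b k)\<^sup>2 + exp R * exp (- \<bar>Im k\<bar>))) summable_on Z"
        by (intro summable_on_cmult_right envelope_majorant b)
      fix k z assume k: "k \<in> Z" and z: "z \<in> cball (0 :: complex) R"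
      have zR: "cmod z \<le> R" "\<bar>Im z\<bar> \<le> R" using z abs_Im_le_cmod[of z] by auto
      have "cmod (a k * B k z) \<le> C * exp (pi / 2 * (cmod z)\<^sup>2) * (b k * exp (- \<bar>Im k - Im z\<bar>))"
        by (rule term_le[OF k])
      also have "\<dots> \<le> C * exp (pi / 2 * R\<^sup>2) * ((b k)\<^sup>2 + exp R * exp (- \<bar>Im k\<bar>))"
        using C(1) zR b k by (intro mult_mono envelope_majorant(2)) (auto intro!: mult_left_mono power_mono)
      finally show "cmod (a k * B k z) \<le> C * exp (pi / 2 * R\<^sup>2) * ((b k)\<^sup>2 + exp R * exp (- \<bar>Im k\<bar>))" .
    qed
    have hol_sum: "eventually (\<lambda>A. (\<lambda>z. \<Sum>k\<in>A. a k * B k z) holomorphic_on UNIV) (finite_subsets_at_top Z)"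
      using B(1) by (intro eventually_finite_subsets_at_top_weakI holomorphic_intros) auto
    note limits = tendsto_true_poly[OF lim finite_subsets_at_top_neq_bot hol_sum]
    have F0_bound: "cmod (F\<^sub>0 z) * exp (- pi / 2 * (cmod z)\<^sup>2) \<le> C * envelope b (Im z)" for z
    proof -
      let ?g = "\<lambda>k. C * exp (pi / 2 * (cmod z)\<^sup>2) * (b k * exp (- \<bar>Im k - Im z\<bar>))"
      have g: "?g summable_on Z" by (intro summable_on_cmult_right summable_envelope b)
      have abs: "(\<lambda>k. cmod (a k * B k z)) summable_on Z"
        by (rule summable_on_comparison_test[OF g term_le]) auto
      have "cmod (F\<^sub>0 z) \<le> (\<Sum>\<^sub>\<infinity>k\<in>Z. cmod (a k * B k z))"
        unfolding F\<^sub>0_def by (rule norm_infsum_bound[OF abs])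
      also have "\<dots> \<le> infsum ?g Z" by (rule infsum_mono[OF abs g term_le])
      also have "\<dots> = C * exp (pi / 2 * (cmod z)\<^sup>2) * envelope b (Im z)"
        unfolding envelope_def by (rule infsum_cmult_right')
      finally have "cmod (F\<^sub>0 z) * exp (- pi / 2 * (cmod z)\<^sup>2) \<le>
          C * exp (pi / 2 * (cmod z)\<^sup>2) * envelope b (Im z) * exp (- pi / 2 * (cmod z)\<^sup>2)"
        by (rule mult_right_mono) simp
      also have "\<dots> = C * envelope b (Im z) * (exp (pi / 2 * (cmod z)\<^sup>2) * exp (- pi / 2 * (cmod z)\<^sup>2))"
        by (simp only: mult_ac)
      also have "exp (pi / 2 * (cmod z)\<^sup>2) * exp (- pi / 2 * (cmod z)\<^sup>2) = 1" by (simp flip: exp_add)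
      finally show ?thesis by simp
    qed
    have "quasi_periodic \<nu> F\<^sub>0" unfolding quasi_periodic_def
    proof (intro allI)
      fix z :: complex and m :: int
      let ?e = "exp (2 * of_real pi * \<i> * of_int m * of_real \<nu>) * exp (of_real pi / 2 * (of_int m)\<^sup>2 + of_real pi * z * of_int m)"
      have "F\<^sub>0 (z + of_int m) = (\<Sum>\<^sub>\<infinity>k\<in>Z. ?e * (a k * B k z))"
        unfolding F\<^sub>0_def using B(2) by (intro infsum_cong) (simp add: quasi_periodic_def)
      also have "\<dots> = ?e * F\<^sub>0 z" unfolding F\<^sub>0_def by (rule infsum_cmult_right')
      finally show "F\<^sub>0 (z + of_int m) = ?e * F\<^sub>0 z" .
    qed
    moreover have "fock_square_integrable F\<^sub>0"
      using C(1) by (intro fock_norm_le_of_envelope[OF b _ _ F0_bound] holomorphic_on_imp_continuous_on limits) auto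
    ultimately have "true_poly r F\<^sub>0 \<in> true_poly_fock_space \<nu> r"
      unfolding true_poly_fock_space_def fock_space_def using limits(1) by blast
    moreover have "true_poly r F\<^sub>0 j = a j" if j: "j \<in> Z" for j
    proof -
      have "eventually (\<lambda>A. true_poly r (\<lambda>z. \<Sum>k\<in>A. a k * B k z) j = a j) (finite_subsets_at_top Z)"
        unfolding eventually_finite_subsets_at_top
      proof (intro exI[of _ "{j}"] conjI allI impI)
        fix A assume A: "finite A \<and> {j} \<subseteq> A \<and> A \<subseteq> Z"
        hence "true_poly r (\<lambda>z. \<Sum>k\<in>A. a k * B k z) j = (\<Sum>k\<in>A. a k * true_poly r (B k) j)"
          using B(1) by (intro true_poly_sum) auto
        also have "\<dots> = (\<Sum>k\<in>A. if k = j then a k else 0)"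
          using A B(3) j by (intro sum.cong) auto
        also have "\<dots> = a j" using A by simp
        finally show "true_poly r (\<lambda>z. \<Sum>k\<in>A. a k * B k z) j = a j" .
      qed (use j in auto)
      hence "((\<lambda>A. true_poly r (\<lambda>z. \<Sum>k\<in>A. a k * B k z) j) \<longlongrightarrow> a j) (finite_subsets_at_top Z)"
        by (rule tendsto_eventually)
      thus ?thesis using limits(2) tendsto_unique finite_subsets_at_top_neq_bot by blast
    qed
    moreover have bound: "cmod (true_poly r F\<^sub>0 w) * exp (- pi / 2 * (cmod w)\<^sup>2) \<le> K * envelope b (Im w)" for w
    proof -
      have circle: "cmod (F\<^sub>0 z) * exp (- pi / 2 * (cmod z)\<^sup>2) \<le> C * (exp 1 * envelope b (Im w))" if "cmod (z - w) = 1" for z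
      proof -
        have "\<bar>Im z - Im w\<bar> \<le> 1" using abs_Im_le_cmod[of "z - w"] that by simp
        hence "C * envelope b (Im z) \<le> C * (exp 1 * envelope b (Im w))"
          using C(1) by (intro mult_left_mono envelope_mono_shift b) auto
        thus ?thesis using F0_bound[of z] by linarith
      qed
      have "cmod (true_poly r F\<^sub>0 w) * exp (- pi / 2 * (cmod w)\<^sup>2)
          \<le> sqrt (pi ^ r / fact r) * fact r * exp (pi / 2) * (C * (exp 1 * envelope b (Im w)))"
        by (rule true_poly_bound[OF limits(1) circle])
      thus ?thesis by (simp only: K_def mult.assoc)
    qed
    have "continuous_on UNIV (true_poly r F\<^sub>0)" by (rule continuous_true_poly[OF limits(1)])
    note norm = fock_norm_le_of_envelope[OF b this K bound]
    ultimately show "\<exists>F\<in>true_poly_fock_space \<nu> r. (\<forall>z\<in>Z. F z = a z) \<and> fock_square_integrable F \<and>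
        fock_norm F \<le> K * sqrt (expsum 1 * (2 * (\<Sum>m. exp (- real m)))) *
          sqrt (\<Sum>\<^sub>\<infinity>z\<in>Z. (cmod (a z))\<^sup>2 * exp (- pi * (cmod z)\<^sup>2))"
      using norm unfolding b2 by blast
  qed
qed

end

text \<open>The upper limit provides one height \<open>\<rho>\<close> and one \<open>d < 1 / (r + 1)\<close> such that every box of height
  \<open>\<rho>\<close> contains at most \<open>d \<rho>\<close> points, the form of the condition that a comparison with the lattice of step \<open>\<rho>\<close> calls for.\<close>

theorem theorem3:
  fixes \<nu> :: real and r :: nat and Z :: "complex set"
  assumes "Z \<subseteq> strip"
    and "separated Z"
    and "upper_beurling_density Z < ennreal (1 / (real r + 1))"
  shows "interpolating \<nu> r Z"
proof -
  let ?n = "\<lambda>\<rho> w. emeasure (count_space UNIV) (Z \<inter> box_at w \<rho>)"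
  have "eventually (\<lambda>\<rho>. (SUP w. ?n \<rho> w / ennreal \<rho>) < ennreal (1 / (real r + 1))) at_top"
    using assms(3) unfolding upper_beurling_density_def by (rule Limsup_lessD)
  hence "eventually (\<lambda>\<rho>. (SUP w. ?n \<rho> w / ennreal \<rho>) < ennreal (1 / (real r + 1)) \<and> \<rho> > 0) at_top"
    using eventually_gt_at_top by (rule eventually_conj)
  then obtain \<rho> where \<rho>: "(SUP w. ?n \<rho> w / ennreal \<rho>) < ennreal (1 / (real r + 1))" "\<rho> > 0"
    by (auto dest!: eventually_happens)
  obtain d where d: "(SUP w. ?n \<rho> w / ennreal \<rho>) = ennreal d" "0 \<le> d" "d < 1 / (real r + 1)"
  proof -
    obtain d where "(SUP w. ?n \<rho> w / ennreal \<rho>) = ennreal d" "0 \<le> d"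
      using \<rho>(1) by (cases "SUP w. ?n \<rho> w / ennreal \<rho>") (auto simp: top_unique)
    thus thesis using that[of d] \<rho>(1) by (simp add: ennreal_less_iff)
  qed
  obtain \<delta> where \<delta>: "\<delta> > 0" "\<And>z w m. z \<in> Z \<Longrightarrow> w \<in> Z \<Longrightarrow> z \<noteq> w \<Longrightarrow> \<delta> \<le> cmod (z - w + of_int m)"
    using assms(2) unfolding separated_def by blast
  have slab: "finite {z \<in> Z. y \<le> Im z \<and> Im z \<le> y + \<rho>} \<and> real (card {z \<in> Z. y \<le> Im z \<and> Im z \<le> y + \<rho>}) \<le> d * \<rho>" for y
  proof -
    let ?S = "{z \<in> Z. y \<le> Im z \<and> Im z \<le> y + \<rho>}"
    have S: "Z \<inter> box_at (Complex 0 (y + \<rho> / 2)) \<rho> = ?S"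
      using assms(1) by (auto simp: box_at_def strip_def)
    have "emeasure (count_space UNIV) ?S / ennreal \<rho> \<le> ennreal d"
      unfolding d(1)[symmetric] S[symmetric] by (rule SUP_upper) simp
    hence "emeasure (count_space UNIV) ?S / ennreal \<rho> * ennreal \<rho> \<le> ennreal d * ennreal \<rho>"
      by (rule mult_right_mono) simp
    hence le: "emeasure (count_space UNIV) ?S \<le> ennreal (d * \<rho>)"
      using \<rho>(2) d(2) by (simp add: ennreal_mult ennreal_divide_times)
    have fin: "finite ?S"
    proof (rule ccontr)
      assume "infinite ?S"
      hence "emeasure (count_space UNIV) ?S = \<infinity>" by simp
      thus False using le by (simp add: top_unique)
    qed
    have "ennreal (real (card ?S)) \<le> ennreal (d * \<rho>)"
      using le fin by (simp add: emeasure_count_space ennreal_of_nat_eq_real_of_nat)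
    thus ?thesis using fin d(2) \<rho>(2) by (simp add: ennreal_le_iff)
  qed
  interpret sparse_points Z \<rho> "d * \<rho>" \<delta>
    using slab \<rho>(2) \<delta> by unfold_locales auto
  have "(real r + 1) * d < 1" using d(3) by (simp add: field_simps)
  hence "(real r + 1) * (d * \<rho>) < \<rho>" using \<rho>(2) mult_strict_right_mono[of "(real r + 1) * d" 1 \<rho>] by (simp add: mult_ac)
  thus ?thesis by (rule interpolating_of_sparse)
qed

end
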